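(* For any tree $T$, $\gamma_{rI}(T)=(|V(T)|+3)/2$ if and only if $T\in\mathcal{J}$ (up to isomorphism), where $\mathcal{J}=\{T_1,T_2,T_3,T_4,T_5\}\cup\{T_{4,k}: k\ge 1\}$ is the family of trees described in the context.
   Context: All graphs are finite and simple. For $f:V(G)\to\{0,1,2\}$, the weight is $\omega(f)=\sum_{v\in V(G)}f(v)$ and $V_i=\{v: f(v)=i\}$. An Italian dominating function of $G$ is a function $f:V(G)\to\{0,1,2\}$ such that every $v$ with $f(v)=0$ satisfies $\sum_{u\in N(v)}f(u)\ge 2$. A restrained Italian dominating (RID) function is an Italian dominating function for which the induced subgraph $G[V_0]$ has no isolated vertices; $\gamma_{rI}(G)$ is the minimum weight of an RID function of $G$. The double star $S_{p,q}$ is the tree with exactly two non-leaf vertices (which are adjacent), one adjacent to $p$ leaves and the other adjacent to $q$ leaves. The family $\mathcal{J}$ consists of the following trees. - $T_1=P_3$, the path on 3 vertices. - $T_2=S_{2,3}$. - $T_3$: the tree on 9 vertices obtained from a path $P_3$ by attaching two pendant leaves to each of its three vertices. - $T_4$: the tree on 11 vertices obtained from two disjoint copies of $S_{2,2}$ by identifying one leaf of the first copy with one leaf of the second copy. Explicitly, it has vertices $a,a_1,a_2,b,b_1,b_2,w,w_1,u,v,v'$ and edges $ab,aa_1,aa_2,bb_1,bb_2,b_2w,ww_1,wu,uv,uv'$. - $T_5$: the tree on 7 vertices obtained from $S_{2,2}$ by joining a new vertex to one of its leaves. - $T_{4,k}$ for $k\ge 1$: the tree on $4k+1$ vertices obtained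 from $k$ disjoint copies of the star $K_{1,3}$ by adding one new vertex $z$ and joining $z$ to exactly one leaf of each copy. *)

theory Defs
  imports Complex_Main "HOL-Library.FuncSet" "Graph_Theory.Graph_Theory"
begin

text \<open>
  A finite simple graph is a \<^locale>\<open>pair_graph\<close>: finite, loop-free, with a symmetric set
  of arcs, so that each edge \<open>uv\<close> is represented by the two arcs \<open>(u, v)\<close> and \<open>(v, u)\<close>.
  The predicate \<^const>\<open>tree\<close> of the library is not suitable for this encoding, because the
  arcs \<open>(u, v)\<close>, \<open>(v, u)\<close> already form a directed cycle (of length 2); the cycles of the
  graph are the directed cycles of length at least 3. The library's \<^const>\<open>connected\<close>
  includes non-emptiness.
\<close>

definition graph_tree :: "'a pair_pre_digraph \<Rightarrow> bool" where
  "graph_tree G \<longleftrightarrow> pair_graph G \<and> connected (with_proj G) \<and>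
     \<not> (\<exists>p. pre_digraph.cycle (with_proj G) p \<and> 3 \<le> length p)"

definition nbhd :: "('a, 'b) pre_digraph \<Rightarrow> 'a \<Rightarrow> 'a set" where
  "nbhd G v = {u \<in> verts G. v \<rightarrow>\<^bsub>G\<^esub> u}"

definition isolated :: "('a, 'b) pre_digraph \<Rightarrow> 'a \<Rightarrow> bool" where
  "isolated G v \<longleftrightarrow> v \<in> verts G \<and> in_arcs G v = {} \<and> out_arcs G v = {}"

definition weight :: "('a, 'b) pre_digraph \<Rightarrow> ('a \<Rightarrow> nat) \<Rightarrow> nat" where
  "weight G f = (\<Sum>v\<in>verts G. f v)"

definition level :: "('a, 'b) pre_digraph \<Rightarrow> ('a \<Rightarrow> nat) \<Rightarrow> nat \<Rightarrow> 'a set" where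
  "level G f i = {v \<in> verts G. f v = i}"

text \<open>Values of \<open>f\<close> outside the vertex set are irrelevant and left unconstrained.\<close>

definition italian_dominating :: "('a, 'b) pre_digraph \<Rightarrow> ('a \<Rightarrow> nat) \<Rightarrow> bool" where
  "italian_dominating G f \<longleftrightarrow> f \<in> verts G \<rightarrow> {0, 1, 2} \<and>
     (\<forall>v\<in>verts G. f v = 0 \<longrightarrow> 2 \<le> (\<Sum>u\<in>nbhd G v. f u))"

definition restrained_italian_dominating ::
    "('a, 'b) pre_digraph \<Rightarrow> ('a \<Rightarrow> nat) \<Rightarrow> bool" where
  "restrained_italian_dominating G f \<longleftrightarrow> italian_dominating G f \<and>
     \<not> (\<exists>v. isolated (G \<restriction> level G f 0) v)"

text \<open>The minimum exists for every graph, since the constant function 1 qualifies.\<close>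

definition gamma_rI :: "('a, 'b) pre_digraph \<Rightarrow> nat" where
  "gamma_rI G = (LEAST k. \<exists>f. restrained_italian_dominating G f \<and> weight G f = k)"

text \<open>The graph without isolated vertices whose edges are the given pairs, read as unordered.\<close>

definition edge_graph :: "('a \<times> 'a) set \<Rightarrow> 'a pair_pre_digraph" where
  "edge_graph A = \<lparr> pverts = fst ` A \<union> snd ` A, parcs = A \<union> A\<inverse> \<rparr>"

text \<open>The non-leaf vertices are 0 (with \<open>p\<close> leaves) and 1 (with \<open>q\<close> leaves).\<close>

definition double_star :: "nat \<Rightarrow> nat \<Rightarrow> nat pair_pre_digraph" where
  "double_star p q = edge_graph
     ({(0, 1)} \<union> {(0, 2 + i) | i. i < p} \<union> {(1, 2 + p + i) | i. i < q})"

definition T1 :: "nat pair_pre_digraph" where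
  "T1 = edge_graph {(0, 1), (1, 2)}"

definition T2 :: "nat pair_pre_digraph" where
  "T2 = double_star 2 3"

definition T3 :: "nat pair_pre_digraph" where
  "T3 = edge_graph ({(0, 1), (1, 2)} \<union> {(0, 3), (0, 4), (1, 5), (1, 6), (2, 7), (2, 8)})"

text \<open>
  The vertices \<open>a, a\<^sub>1, a\<^sub>2, b, b\<^sub>1, b\<^sub>2, w, w\<^sub>1, u, v, v'\<close> are numbered
  0 to 10 in this order; \<open>b\<^sub>2\<close> (number 5) is the identified leaf.
\<close>

definition T4 :: "nat pair_pre_digraph" where
  "T4 = edge_graph {(0, 3), (0, 1), (0, 2), (3, 4), (3, 5),
                    (5, 6), (6, 7), (6, 8), (8, 9), (8, 10)}"

text \<open>
  The leaves of \<^term>\<open>double_star 2 2\<close> are 2, 3, 4, 5; by symmetry it does not matter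
  which one is joined to the new vertex 6.
\<close>

definition T5 :: "nat pair_pre_digraph" where
  "T5 = edge_graph (parcs (double_star 2 2) \<union> {(5, 6)})"

text \<open>
  The new vertex \<open>z\<close> is 0. Copy number \<open>i\<close> of the star has centre \<open>4 * i + 1\<close> and
  leaves \<open>4 * i + 2\<close>, \<open>4 * i + 3\<close>, \<open>4 * i + 4\<close>, the first of which is joined to \<open>z\<close>.
\<close>

definition T4k :: "nat \<Rightarrow> nat pair_pre_digraph" where
  "T4k k = edge_graph (\<Union>i<k. {(4 * i + 1, 4 * i + 2), (4 * i + 1, 4 * i + 3),
                               (4 * i + 1, 4 * i + 4), (0, 4 * i + 2)})"

definition family_J :: "nat pair_pre_digraph set" where
  "family_J = {T1, T2, T3, T4, T5} \<union> {T4k k | k. 1 \<le> k}"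

end

theory Submission
  imports Defs
begin

text \<open>
  In a tree, any nonempty set \<open>S\<close> of vertices spans at most \<open>|S| - 1\<close> edges, with equality for the
  whole vertex set. Let \<open>f\<close> be an RID function with levels of sizes \<open>n\<^sub>0, n\<^sub>1, n\<^sub>2\<close>, and let \<open>e\<^sub>i\<^sub>j\<close>
  count the edges between levels. Domination gives \<open>e\<^sub>0\<^sub>1 + 2 e\<^sub>0\<^sub>2 \<ge> 2 n\<^sub>0\<close>, and the absence of isolated
  vertices in level 0 gives \<open>e\<^sub>0\<^sub>0 \<ge> n\<^sub>0 / 2\<close>. If \<open>n\<^sub>2 \<noteq> 0\<close>, adding the edge count of the whole tree to
  the bound for levels 0 and 2 together yields \<open>n\<^sub>1 + 2 n\<^sub>2 \<ge> n\<^sub>0 + 2\<close>, hence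
  \<open>2 \<omega>(f) \<ge> |V| + 2 + n\<^sub>2\<close>. If \<open>n\<^sub>2 = 0\<close>, the edge count alone yields \<open>2 n\<^sub>1 \<ge> 3 n\<^sub>0 + 2\<close>. So
  \<open>2 \<omega>(f) \<ge> |V| + 3\<close> unless \<open>|V|\<close> is 1, 2 or 6. Equality forces either \<open>n\<^sub>2 = 1\<close>, with level 0 an
  induced matching each of whose edges has exactly one end adjacent to the vertex of value 2
  (\<open>T\<^sub>4\<^sub>,\<^sub>k\<close>), or \<open>n\<^sub>2 = 0\<close> and \<open>n\<^sub>0 \<in> {0, 2, 3, 4}\<close> (\<open>T\<^sub>1\<close>; \<open>T\<^sub>2\<close> and \<open>T\<^sub>5\<close>; \<open>T\<^sub>3\<close>; \<open>T\<^sub>4\<close>).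
\<close>

section \<open>Trees as sparse relations\<close>

locale simple_graph =
  fixes V :: "'a set" and E :: "('a \<times> 'a) set"
  assumes finite_V: "finite V"
    and E_subset: "E \<subseteq> V \<times> V"
    and sym_E: "sym E"
    and irrefl_E: "irrefl E"
begin

lemma finite_E [simp]: "finite E"
  using E_subset finite_V by (meson finite_SigmaI finite_subset)

lemma finite_subset_V: "S \<subseteq> V \<Longrightarrow> finite S"
  using finite_V finite_subset by blast

lemma adj_sym: "(u, v) \<in> E \<Longrightarrow> (v, u) \<in> E"
  using sym_E by (auto dest: symD)

lemma adj_neq: "(u, v) \<in> E \<Longrightarrow> u \<noteq> v"
  using irrefl_E by (auto simp: irrefl_def)

lemma adj_V: "(u, v) \<in> E \<Longrightarrow> u \<in> V \<and> v \<in> V"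
  using E_subset by auto

definition deg :: "'a set \<Rightarrow> 'a \<Rightarrow> nat" where
  "deg S v = card (E `` {v} \<inter> S)"

lemma finite_nbrs [simp]: "finite (E `` {v} \<inter> S)" "finite (E `` {v})"
  using finite_subset_V[of "E `` {v}"] E_subset by auto

lemma card_arcs_eq_sum_deg:
  assumes "finite S"
  shows "card (E \<inter> S \<times> T) = (\<Sum>v\<in>S. deg T v)"
proof -
  have "E \<inter> S \<times> T = (SIGMA v:S. E `` {v} \<inter> T)" by auto
  then show ?thesis using assms by (simp add: deg_def)
qed

lemma card_arcs_commute: "card (E \<inter> S \<times> T) = card (E \<inter> T \<times> S)"
proof -
  have "(E \<inter> S \<times> T)\<inverse> = E \<inter> T \<times> S" using adj_sym by auto
  then show ?thesis by (metis card_inverse)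
qed

lemma card_arcs_Un:
  assumes "A \<inter> B = {}"
  shows "card (E \<inter> S \<times> (A \<union> B)) = card (E \<inter> S \<times> A) + card (E \<inter> S \<times> B)"
proof -
  have "E \<inter> S \<times> (A \<union> B) = (E \<inter> S \<times> A) \<union> (E \<inter> S \<times> B)" by auto
  then show ?thesis using assms by (simp add: card_Un_disjoint disjoint_iff)
qed

text \<open>Arcs are counted, so every edge from \<open>x\<close> into \<open>S\<close> contributes
  twice; irreflexivity rules out an extra arc at \<open>x\<close> itself.\<close>

lemma card_arcs_insert:
  assumes "x \<notin> S"
  shows "card (E \<inter> insert x S \<times> insert x S) = card (E \<inter> S \<times> S) + 2 * deg S x"
proof -
  have loop: "E \<inter> {x} \<times> {x} = {}" using adj_neq by auto
  have "deg S x = card (E \<inter> {x} \<times> S)" by (simp add: card_arcs_eq_sum_deg)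
  moreover have "card (E \<inter> ({x} \<union> S) \<times> ({x} \<union> S)) =
      card (E \<inter> ({x} \<union> S) \<times> {x}) + card (E \<inter> ({x} \<union> S) \<times> S)"
    using assms by (intro card_arcs_Un) auto
  moreover have "card (E \<inter> T \<times> ({x} \<union> S)) = card (E \<inter> T \<times> {x}) + card (E \<inter> T \<times> S)" for T
    using assms by (intro card_arcs_Un) auto
  ultimately show ?thesis
    using card_arcs_commute[of "{x} \<union> S"] card_arcs_commute[of S "{x}"] loop by simp
qed

text \<open>Building \<open>S\<close> up vertex by vertex adds an even number of arcs each time.
  This parity decides the case \<open>n 0 = 3\<close> of the equality analysis.\<close>

lemma even_card_arcs: "finite S \<Longrightarrow> even (card (E \<inter> S \<times> S))"

proof (induction S rule: finite_induct)
  case (insert x S)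
  then show ?case unfolding card_arcs_insert[OF insert.hyps(2)] by simp
qed simp

text \<open>Longest path argument: all neighbours in \<open>S\<close> of the first vertex
  \<open>x\<close> of a longest path lie on that path, and one of them differs from the successor of
  \<open>x\<close>. Going back to it closes a cycle. The result has the shape \<open>u # p\<close>
  with \<open>p\<close> distinct and ending in \<open>u\<close>, which fits the definition of a
  directed cycle.\<close>

lemma ex_closed_path:
  assumes "S \<noteq> {}" "S \<subseteq> V" and deg2: "\<And>v. v \<in> S \<Longrightarrow> 2 \<le> deg S v"
  obtains u p where "set (vwalk_arcs (u # p)) \<subseteq> E" "distinct p" "last p = u" "3 \<le> length p"
proof -
  define P where "P xs \<longleftrightarrow> xs \<noteq> [] \<and> distinct xs \<and> set xs \<subseteq> S \<and> set (vwalk_arcs xs) \<subseteq> E" for xs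
  obtain s where "s \<in> S" using assms by auto
  then have "P [s]" by (simp add: P_def)
  moreover have "length xs < Suc (card S)" if "P xs" for xs
    using that finite_subset_V[OF \<open>S \<subseteq> V\<close>]
    by (metis P_def card_mono distinct_card le_imp_less_Suc)
  ultimately obtain xs where xs: "P xs" and maxi: "\<And>ys. P ys \<Longrightarrow> length ys \<le> length xs"
    using ex_has_greatest_nat[of P "[s]" length "Suc (card S)"] by blast
  obtain x ys where xs_eq: "xs = x # ys" using xs by (cases xs) (auto simp: P_def)
  have "x \<in> S" using xs xs_eq by (auto simp: P_def)
  have nbr: "u \<in> set ys" if "(x, u) \<in> E" "u \<in> S" for u
  proof (rule ccontr)
    assume "u \<notin> set ys"
    then have "P (u # xs)" using xs xs_eq that adj_sym adj_neq by (auto simp: P_def)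
    then show False using maxi by fastforce
  qed
  \<comment> \<open>Used twice: with \<open>x\<close> itself it shows that the path has a second
    vertex, and with that second vertex \<open>y\<close> it yields the chord from \<open>x\<close>
    to \<open>u\<close>.\<close>
  have not_sub: "\<not> E `` {x} \<inter> S \<subseteq> {y}" for y
    using deg2[OF \<open>x \<in> S\<close>] card_mono[of "{y}" "E `` {x} \<inter> S"] by (auto simp: deg_def)
  obtain y zs where ys: "ys = y # zs" using nbr not_sub[of x] by (cases ys) auto
  obtain u where u: "(x, u) \<in> E" "u \<in> S" "u \<noteq> y" using not_sub[of y] by auto
  then have "u \<in> set zs" using nbr ys by auto
  then obtain as bs where zs: "zs = as @ u # bs" by (meson split_list)
  have "set (vwalk_arcs (x # y # as @ [u])) \<subseteq> set (vwalk_arcs xs)"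
    using set_vwalk_arcs_append1[of "x # y # as @ [u]" bs] xs_eq ys zs by simp
  then have "set (vwalk_arcs (u # x # y # as @ [u])) \<subseteq> E"
    using xs u adj_sym by (auto simp: P_def)
  then show thesis
    by (rule that) (use xs xs_eq ys zs in \<open>auto simp: P_def\<close>)
qed

end

section \<open>From connected acyclic graphs to arc counts\<close>

lemma pcas_vwalk_arcs: "pcas u (vwalk_arcs (u # p)) (last (u # p))"
  by (induction p arbitrary: u) auto

lemma pawalk_verts_vwalk_arcs: "pawalk_verts u (vwalk_arcs (u # p)) = u # p"
  by (induction p arbitrary: u) auto

text \<open>The numbers are twice the usual edge numbers. The bound for all \<open>S\<close> encodes
  acyclicity, and equality for \<open>V\<close> adds connectedness. Writing \<open>+ 2\<close> on
  the left avoids truncated subtraction.\<close>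

locale sparse_tree = simple_graph +
  assumes V_nonempty: "V \<noteq> {}"
    and sparse: "S \<subseteq> V \<Longrightarrow> S \<noteq> {} \<Longrightarrow> card (E \<inter> S \<times> S) + 2 \<le> 2 * card S"
    and card_E: "card E + 2 = 2 * card V"

lemma pair_graph_imp_simple_graph:
  assumes "pair_graph G"
  shows "simple_graph (pverts G) (parcs G)"
proof -
  interpret pair_graph G by fact
  show ?thesis
    using pair_sym_arcs in_arcsD1 in_arcsD2
    by unfold_locales (auto simp: irrefl_def symmetric_def dest: no_loops')
qed

text \<open>Sparsity follows by repeatedly deleting a vertex of degree at most 1, which acyclicity
  provides. The reverse inequality for the whole vertex set comes from connectedness, by growing a
  set from a single vertex.\<close>

lemma graph_tree_imp_sparse_tree:
  assumes "graph_tree T"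
  shows "sparse_tree (pverts T) (parcs T)"
proof -
  let ?V = "pverts T" and ?E = "parcs T"
  from assms have pg: "pair_graph T" and conn: "connected (with_proj T)"
    and acyclic: "\<And>p. pre_digraph.cycle (with_proj T) p \<Longrightarrow> \<not> 3 \<le> length p"
    by (auto simp: graph_tree_def)
  interpret pair_graph T by (rule pg)
  interpret simple_graph ?V ?E by (rule pair_graph_imp_simple_graph[OF pg])
  have sc: "strongly_connected (with_proj T)"
    using conn pair_sym_arcs symmetric_connected_imp_strongly_connected by blast
  have sparse: "card (?E \<inter> S \<times> S) + 2 \<le> 2 * card S" if "S \<subseteq> ?V" "S \<noteq> {}" for S
    using that
  proof (induction "card S" arbitrary: S rule: less_induct)
    case less
    note fin = finite_subset_V[OF less.prems(1)]
    \<comment> \<open>Otherwise \<open>ex_closed_path\<close> applies to \<open>S\<close> and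
      produces a directed cycle of length at least 3.\<close>
    have "\<exists>v\<in>S. deg S v \<le> 1"
    proof (rule ccontr)
      assume "\<not> ?thesis"
      then have "2 \<le> deg S v" if "v \<in> S" for v using that by fastforce
      with less.prems obtain u p where p: "set (vwalk_arcs (u # p)) \<subseteq> ?E" "distinct p"
        "last p = u" "3 \<le> length p" by (metis ex_closed_path)
      then have ne: "p \<noteq> []" by auto
      have "u \<in> ?V" using p ne adj_V by auto
      then have "awalk u (vwalk_arcs (u # p)) u"
        using p ne pcas_vwalk_arcs[of u p] by (simp add: awalk_def)
      moreover have "distinct (tl (pawalk_verts u (vwalk_arcs (u # p))))"
        using p by (simp only: pawalk_verts_vwalk_arcs) simp
      ultimately have "cycle (vwalk_arcs (u # p))"
        using ne unfolding cycle_def by auto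
      moreover have "3 \<le> length (vwalk_arcs (u # p))"
        using vwalk_length_simp[of "u # p"] p unfolding vwalk_length_def by simp
      ultimately show False using acyclic by blast
    qed
    then obtain v where v: "v \<in> S" "deg S v \<le> 1" by blast
    let ?S = "S - {v}"
    have "deg ?S v \<le> deg S v" unfolding deg_def by (intro card_mono) auto
    moreover have "card (?E \<inter> S \<times> S) = card (?E \<inter> ?S \<times> ?S) + 2 * deg ?S v"
      using card_arcs_insert[of v ?S] unfolding insert_Diff[OF v(1)] by blast
    ultimately have ar: "card (?E \<inter> S \<times> S) \<le> card (?E \<inter> ?S \<times> ?S) + 2"
      using v(2) by linarith
    have c: "card S = Suc (card ?S)" using card.remove[OF fin v(1)] .
    show ?case
    proof (cases "?S = {}")
      case True
      then have "S = {v}" using v by auto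
      then show ?thesis using adj_neq[of v v] by (auto simp: Int_absorb)
    next
      case False
      then have "card (?E \<inter> ?S \<times> ?S) + 2 \<le> 2 * card ?S"
        using less.hyps[of ?S] less.prems c by auto
      then show ?thesis using ar c by simp
    qed
  qed
  obtain r where r: "r \<in> ?V" using sc by (auto simp: strongly_connected_def)
  \<comment> \<open>\<open>P\<close> holds for singletons and survives adding a neighbour, since one
    new vertex brings at least two new arcs. A largest set with \<open>P\<close> is therefore closed
    under adjacency and, by reachability, is all of \<open>?V\<close>.\<close>
  define P where "P S \<longleftrightarrow> S \<subseteq> ?V \<and> S \<noteq> {} \<and> 2 * card S \<le> card (?E \<inter> S \<times> S) + 2" for S
  have "P {r}" using r by (simp add: P_def)
  moreover have "card S < Suc (card ?V)" if "P S" for S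
    using that finite_V by (simp add: P_def card_mono less_Suc_eq_le)
  ultimately obtain S where S: "P S" and maxi: "\<And>S'. P S' \<Longrightarrow> card S' \<le> card S"
    using ex_has_greatest_nat[of P "{r}" card "Suc (card ?V)"] by blast
  have fin: "finite S" using S finite_subset_V by (auto simp: P_def)
  obtain s where s: "s \<in> S" using S by (auto simp: P_def)
  have closed: "v \<in> S" if "u \<in> S" "(u, v) \<in> ?E" for u v
  proof (rule ccontr)
    assume v: "v \<notin> S"
    have "u \<in> ?E `` {v} \<inter> S" using that adj_sym by auto
    then have "1 \<le> deg S v" unfolding deg_def by (metis One_nat_def Suc_leI card_gt_0_iff empty_iff finite_nbrs(1))
    then have "P (insert v S)"
      using S v fin card_arcs_insert[OF v] that adj_V by (auto simp: P_def)
    then show False using maxi fin v by fastforce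
  qed
  have "?V \<subseteq> S"
  proof
    fix v assume "v \<in> ?V"
    then have "s \<rightarrow>\<^sup>*\<^bsub>with_proj T\<^esub> v" using sc s S by (auto simp: strongly_connected_def P_def)
    then show "v \<in> S" by (induction rule: reachable_induct) (use s closed in auto)
  qed
  then have "S = ?V" using S by (auto simp: P_def)
  moreover have "?E \<inter> ?V \<times> ?V = ?E" using E_subset by auto
  ultimately have "card ?E + 2 = 2 * card ?V"
    using S sparse[of ?V] by (auto simp: P_def)
  then show ?thesis
    using r sparse by unfold_locales auto
qed

section \<open>Connected vertex sets of a tree\<close>

context sparse_tree
begin

text \<open>Equality in the sparsity bound singles out the vertex sets of connected induced
  subgraphs.\<close>

definition subtree :: "'a set \<Rightarrow> bool" where
  "subtree S \<longleftrightarrow> S \<subseteq> V \<and> S \<noteq> {} \<and> card (E \<inter> S \<times> S) + 2 = 2 * card S"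

lemma subtree_singleton: "v \<in> V \<Longrightarrow> subtree {v}"
  using adj_neq[of v v] by (auto simp: subtree_def Int_absorb)

text \<open>Two neighbours in \<open>S\<close> would add four arcs for one vertex, exceeding the
  sparsity bound for \<open>insert x S\<close>.\<close>

lemma deg_le_1:
  assumes "subtree S" "x \<in> V" "x \<notin> S"
  shows "deg S x \<le> 1"
proof -
  have "finite S" using assms finite_subset_V by (auto simp: subtree_def)
  moreover have "card (E \<inter> insert x S \<times> insert x S) + 2 \<le> 2 * card (insert x S)"
    using assms by (intro sparse) (auto simp: subtree_def)
  ultimately show ?thesis
    using assms card_arcs_insert[OF assms(3)] by (simp add: subtree_def del: insert_Times_insert)
qed

lemma subtree_insert:
  assumes "subtree S" "u \<in> S" "(u, x) \<in> E" "x \<notin> S"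
  shows "subtree (insert x S)"
proof -
  have "finite S" using assms finite_subset_V by (auto simp: subtree_def)
  moreover have "u \<in> E `` {x} \<inter> S" using assms adj_sym by auto
  then have "deg S x \<noteq> 0" by (auto simp: deg_def)
  then have "deg S x = 1" using deg_le_1 assms adj_V by fastforce
  ultimately show ?thesis
    using assms card_arcs_insert[OF assms(4)] adj_V
    by (simp add: subtree_def del: insert_Times_insert)
qed

text \<open>A second neighbour would close a cycle through the connected set \<open>S\<close>. This
  is the tool by which the vertices found in the extremal trees are shown to be distinct.\<close>

lemma subtree_nbr_unique:
  assumes "subtree S" "x \<notin> S" "u \<in> S" "v \<in> S" "(u, x) \<in> E" "(v, x) \<in> E"
  shows "u = v"
proof -
  have "{u, v} \<subseteq> E `` {x} \<inter> S" using assms adj_sym by auto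
  then have "card {u, v} \<le> deg S x" unfolding deg_def by (intro card_mono) auto
  also have "\<dots> \<le> 1" using deg_le_1 assms adj_V by blast
  finally show ?thesis by (cases "u = v") auto
qed

lemma no_triangle:
  assumes "(u, v) \<in> E" "(u, x) \<in> E" "(v, x) \<in> E"
  shows False
proof -
  have "subtree {v, u}"
    using assms adj_V adj_neq by (intro subtree_insert[of "{u}" u v] subtree_singleton) auto
  then show False using subtree_nbr_unique[of "{v, u}" x u v] assms adj_neq by blast
qed

text \<open>If \<open>v\<close> were isolated, all arcs would lie within \<open>V - {v}\<close>, too
  many for the sparsity bound there.\<close>

lemma ex_nbr:
  assumes "v \<in> V" "2 \<le> card V"
  obtains u where "(v, u) \<in> E"
proof -
  note V = insert_Diff[OF assms(1)] card.remove[OF finite_V assms(1)]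
  let ?S = "V - {v}"
  have "?S \<noteq> {}"
  proof
    assume "?S = {}"
    then have "card V = 1" using V(2) by (simp only: card.empty One_nat_def)
    then show False using assms(2) by simp
  qed
  then have "card (E \<inter> ?S \<times> ?S) + 2 \<le> 2 * card ?S" by (intro sparse) auto
  moreover have "E \<inter> V \<times> V = E" using E_subset by auto
  then have "card E = card (E \<inter> ?S \<times> ?S) + 2 * deg ?S v"
    using card_arcs_insert[of v ?S] unfolding V(1) by simp
  ultimately have "deg ?S v \<noteq> 0" using card_E V(2) by linarith
  then have "E `` {v} \<inter> (V - {v}) \<noteq> {}" unfolding deg_def by force
  then show thesis using that by blast
qed

end

section \<open>Counting arcs between the levels\<close>

text \<open>The restrained Italian dominating functions in relational form; the absence of isolated
  vertices in level 0 becomes a neighbour of value 0 for every vertex of value 0.\<close>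

definition rid_on :: "'a set \<Rightarrow> ('a \<times> 'a) set \<Rightarrow> ('a \<Rightarrow> nat) \<Rightarrow> bool" where
  "rid_on V E f \<longleftrightarrow> (\<forall>v\<in>V. f v \<le> 2) \<and>
     (\<forall>v\<in>V. f v = 0 \<longrightarrow> 2 \<le> (\<Sum>u\<in>E `` {v}. f u) \<and> (\<exists>u\<in>E `` {v}. f u = 0))"

text \<open>By symmetry of the arcs, a vertex of level 0 has an in-arc in the induced subgraph
  exactly when it has an out-arc, so being isolated there means having no neighbour of value
  0.\<close>

lemma restrained_italian_dominating_iff:
  assumes "pair_graph G"
  shows "restrained_italian_dominating (with_proj G) f \<longleftrightarrow> rid_on (pverts G) (parcs G) f"
proof -
  interpret pair_graph G by fact
  interpret S: simple_graph "pverts G" "parcs G" using assms by (rule pair_graph_imp_simple_graph)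
  have nb: "nbhd (with_proj G) v = parcs G `` {v}" for v
    using S.adj_V by (auto simp: nbhd_def)
  have iso: "isolated (with_proj G \<restriction> level (with_proj G) f 0) v \<longleftrightarrow>
      v \<in> pverts G \<and> f v = 0 \<and> (\<forall>u\<in>parcs G `` {v}. f u \<noteq> 0)" for v
  proof -
    let ?H = "with_proj G \<restriction> level (with_proj G) f 0"
    have arcs_H: "arcs ?H = {a \<in> parcs G. f (fst a) = 0 \<and> f (snd a) = 0}"
      by (auto simp: induce_subgraph_def level_def dest: in_arcsD1 in_arcsD2)
    have H: "verts ?H = {v \<in> pverts G. f v = 0}" "tail ?H = fst" "head ?H = snd"
      by (auto simp: level_def)
    have arcs_at: "out_arcs ?H v = {v} \<times> {u \<in> parcs G `` {v}. f u = 0}"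
      "in_arcs ?H v = {u \<in> parcs G `` {v}. f u = 0} \<times> {v}" if "f v = 0"
      unfolding out_arcs_def in_arcs_def arcs_H H using that S.adj_sym by auto
    show ?thesis
    proof (cases "f v = 0")
      case True
      then show ?thesis unfolding isolated_def H arcs_at[OF True] by auto
    qed (simp add: isolated_def level_def)
  qed
  have "n \<in> {0, 1, 2} \<longleftrightarrow> n \<le> 2" for n :: nat by auto
  then have id: "italian_dominating (with_proj G) f \<longleftrightarrow> (\<forall>v\<in>pverts G. f v \<le> 2) \<and>
      (\<forall>v\<in>pverts G. f v = 0 \<longrightarrow> 2 \<le> (\<Sum>u\<in>parcs G `` {v}. f u))"
    unfolding italian_dominating_def nb Pi_iff with_proj_simps by presburger
  have "(\<exists>v. isolated (with_proj G \<restriction> level (with_proj G) f 0) v) \<longleftrightarrow>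
      (\<exists>v\<in>pverts G. f v = 0 \<and> (\<forall>u\<in>parcs G `` {v}. f u \<noteq> 0))"
    unfolding iso by (simp only: Bex_def)
  then show ?thesis
    unfolding restrained_italian_dominating_def rid_on_def id by meson
qed

locale rid_tree = sparse_tree +
  fixes f :: "'a \<Rightarrow> nat"
  assumes rid: "rid_on V E f"
begin

definition L :: "nat \<Rightarrow> 'a set" where
  "L i = {v \<in> V. f v = i}"

abbreviation n :: "nat \<Rightarrow> nat" where
  "n i \<equiv> card (L i)"

text \<open>Pairs are ordered, so each edge inside a level is counted twice.\<close>

definition e :: "nat \<Rightarrow> nat \<Rightarrow> nat" where
  "e i j = card (E \<inter> L i \<times> L j)"

lemma L_V: "L i \<subseteq> V" "finite (L i)" "i \<noteq> j \<Longrightarrow> L i \<inter> L j = {}"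
  using finite_V by (auto simp: L_def)

lemma V_eq: "V = L 0 \<union> L 1 \<union> L 2"
proof
  show "V \<subseteq> L 0 \<union> L 1 \<union> L 2"
  proof
    fix v assume v: "v \<in> V"
    then have "f v \<le> 2" using rid by (simp add: rid_on_def)
    then consider "f v = 0" | "f v = 1" | "f v = 2" by linarith
    then show "v \<in> L 0 \<union> L 1 \<union> L 2" using v by cases (simp_all add: L_def)
  qed
qed (simp add: L_def)

lemma e_commute: "e i j = e j i"
  unfolding e_def by (rule card_arcs_commute)

lemma card_V: "card V = n 0 + n 1 + n 2"
proof -
  have "card V = card (L 0 \<union> L 1 \<union> L 2)" by (rule arg_cong[OF V_eq])
  then show ?thesis using L_V by (simp add: card_Un_disjoint Int_Un_distrib2)
qed

lemma weight_eq: "sum f V = n 1 + 2 * n 2"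
proof -
  have "sum f V = sum f (L 0 \<union> L 1 \<union> L 2)" by (rule arg_cong[OF V_eq])
  then have "sum f V = sum f (L 0) + sum f (L 1) + sum f (L 2)"
    using L_V by (simp add: sum.union_disjoint Int_Un_distrib2)
  moreover have "sum f (L i) = i * n i" for i
    by (simp add: L_def)
  ultimately show ?thesis by simp
qed

lemma deg_L0: "v \<in> L 0 \<Longrightarrow> 1 \<le> deg (L 0) v"
proof -
  assume "v \<in> L 0"
  then have "\<exists>u\<in>E `` {v}. f u = 0" using rid by (simp add: rid_on_def L_def)
  then obtain u where "u \<in> E `` {v} \<inter> L 0" using adj_V by (auto simp: L_def)
  then show ?thesis unfolding deg_def
    by (metis One_nat_def Suc_leI card_gt_0_iff empty_iff finite_nbrs(1))
qed

text \<open>The neighbourhood splits along the levels, and level \<open>i\<close> contributes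
  \<open>i\<close> times the degree into it to the sum in the domination condition.\<close>

lemma deg_L12:
  assumes "v \<in> L 0"
  shows "2 \<le> deg (L 1) v + 2 * deg (L 2) v"
proof -
  let ?N = "\<lambda>i. E `` {v} \<inter> L i"
  have "E `` {v} = ?N 0 \<union> ?N 1 \<union> ?N 2" using V_eq adj_V by blast
  moreover have "sum f (?N 0 \<union> ?N 1 \<union> ?N 2) = sum f (?N 0) + sum f (?N 1) + sum f (?N 2)"
    by (subst sum.union_disjoint, use L_V in \<open>auto simp: L_def\<close>)
       (subst sum.union_disjoint, use L_V in \<open>auto simp: L_def\<close>)
  moreover have "sum f (?N i) = i * deg (L i) v" for i
    by (simp add: L_def deg_def)
  ultimately have "sum f (E `` {v}) = deg (L 1) v + 2 * deg (L 2) v"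
    by (metis add_0 mult_0 mult_1)
  moreover have "2 \<le> sum f (E `` {v})"
    using rid assms by (simp add: rid_on_def L_def)
  ultimately show ?thesis by simp
qed

lemma e_eq_sum_deg: "e i j = (\<Sum>v\<in>L i. deg (L j) v)"
  unfolding e_def using L_V by (intro card_arcs_eq_sum_deg)

lemma n0_le_e00: "n 0 \<le> e 0 0"
proof -
  have "(\<Sum>v\<in>L 0. 1) \<le> (\<Sum>v\<in>L 0. deg (L 0) v)"
    by (intro sum_mono deg_L0)
  then show ?thesis unfolding e_eq_sum_deg by simp
qed

lemma two_n0_le: "2 * n 0 \<le> e 0 1 + 2 * e 0 2"
proof -
  have "(\<Sum>v\<in>L 0. 2) \<le> (\<Sum>v\<in>L 0. deg (L 1) v + 2 * deg (L 2) v)"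
    by (intro sum_mono deg_L12)
  then show ?thesis unfolding e_eq_sum_deg sum.distrib sum_distrib_left by simp
qed

lemma e_Un: "j \<noteq> k \<Longrightarrow> card (E \<inter> S \<times> (L j \<union> L k)) = card (E \<inter> S \<times> L j) + card (E \<inter> S \<times> L k)"
  using L_V by (intro card_arcs_Un)

lemma e_total: "e 0 0 + e 1 1 + e 2 2 + 2 * (e 0 1 + e 0 2 + e 1 2) + 2 = 2 * (n 0 + n 1 + n 2)"
proof -
  have *: "card (E \<inter> S \<times> V) = card (E \<inter> S \<times> L 0) + card (E \<inter> S \<times> L 1) + card (E \<inter> S \<times> L 2)" for S
    using card_arcs_Un[of "L 0 \<union> L 1" "L 2" S] e_Un[of 0 1 S] L_V
    unfolding V_eq[symmetric] by (simp add: Int_Un_distrib2)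
  have "E \<inter> V \<times> V = E" using E_subset by auto
  then have "card E = card (E \<inter> V \<times> V)" by simp
  also have "\<dots> = e 0 0 + e 1 1 + e 2 2 + 2 * (e 0 1 + e 0 2 + e 1 2)"
    using e_commute unfolding *[of V] card_arcs_commute[of V] *
    by (simp add: e_def[symmetric])
  finally show ?thesis using card_E card_V by simp
qed

text \<open>This is sparsity of \<open>L 0 \<union> L 2\<close>. It limits \<open>e 0 2\<close>, the
  quantity that enters the domination count \<open>two_n0_le\<close> with factor 2.\<close>

lemma e_L02:
  assumes "n 0 + n 2 \<noteq> 0"
  shows "e 0 0 + e 2 2 + 2 * e 0 2 + 2 \<le> 2 * (n 0 + n 2)"
proof -
  let ?S = "L 0 \<union> L 2"
  have "card (E \<inter> ?S \<times> ?S) = e 0 0 + e 2 2 + 2 * e 0 2"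
    using e_commute[of 0 2] e_Un[of 0 2] card_arcs_commute[of ?S]
    by (simp add: e_def[symmetric])
  moreover have "card ?S = n 0 + n 2" using L_V by (intro card_Un_disjoint) auto
  moreover have "?S \<noteq> {}" using assms by auto
  ultimately show ?thesis using sparse[of ?S] L_V by auto
qed

section \<open>The weight bound and its equality cases\<close>

lemma e00_le: "n 0 \<noteq> 0 \<Longrightarrow> e 0 0 + 2 \<le> 2 * n 0"
  unfolding e_def using L_V by (intro sparse) auto

lemma even_e00: "even (e 0 0)"
  unfolding e_def using L_V by (intro even_card_arcs)

lemma e_empty: "n 2 = 0 \<Longrightarrow> e i 2 = 0" "n 0 = 0 \<Longrightarrow> e 0 i = 0"
  using L_V by (auto simp: e_def)

lemma n1_if_n2_eq_0:
  assumes "n 2 = 0"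
  shows "e 0 0 + e 1 1 + 2 * e 0 1 + 2 = 2 * (n 0 + n 1)" "2 * n 0 \<le> e 0 1"
proof -
  show "e 0 0 + e 1 1 + 2 * e 0 1 + 2 = 2 * (n 0 + n 1)"
    using e_total unfolding e_empty(1)[OF assms] assms by simp
  show "2 * n 0 \<le> e 0 1"
    using two_n0_le unfolding e_empty(1)[OF assms] by simp
qed

text \<open>If \<open>n 2 = 0\<close>, the claim is \<open>n 1 \<ge> n 0 + 3\<close>, while counting
  gives \<open>2 * n 1 \<ge> 3 * n 0 + 2\<close>. This suffices except for \<open>n 0 = 0\<close>
  with \<open>n 1 \<le> 2\<close>, for \<open>n 0 = 1\<close>, which cannot occur, and for
  \<open>n 0 = 2\<close> with \<open>n 1 = 4\<close>; hence the excluded orders 1, 2 and 6.\<close>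

lemma weight_lower_bound:
  assumes "card V \<notin> {1, 2, 6}"
  shows "card V + 3 \<le> 2 * sum f V"
proof (cases "n 2 = 0")
  case True
  note n1 = n1_if_n2_eq_0[OF True]
  have "card V \<noteq> 0" using V_nonempty finite_V by simp
  moreover have "n 0 \<noteq> 1" using n0_le_e00 e00_le by force
  ultimately show ?thesis
    using n1 n0_le_e00 card_V weight_eq True assms
    by simp
next
  case False
  then have "1 \<le> n 2" "e 0 0 + e 2 2 + 2 * e 0 2 + 2 \<le> 2 * (n 0 + n 2)" using e_L02 by auto
  then show ?thesis
    using e_total n0_le_e00 two_n0_le unfolding card_V weight_eq by simp
qed

lemma extremal_n2_eq_0:
  assumes "2 * sum f V = card V + 3" "n 2 = 0"
  shows "n 1 = n 0 + 3" "n 0 = 0 \<or> n 0 = 2 \<or> n 0 = 3 \<or> n 0 = 4"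
    "n 0 = 2 \<Longrightarrow> e 0 0 = 2" "n 0 = 3 \<Longrightarrow> e 0 0 = 4" "n 0 = 4 \<Longrightarrow> e 0 0 = 4"
proof -
  note n1 = n1_if_n2_eq_0[OF assms(2)]
  show n3: "n 1 = n 0 + 3" using assms card_V weight_eq by simp
  have le4: "n 0 \<le> 4" using n1 n3 n0_le_e00 by simp
  have "n 0 \<noteq> 1" using n0_le_e00 e00_le by force
  then show "n 0 = 0 \<or> n 0 = 2 \<or> n 0 = 3 \<or> n 0 = 4"
    using le4 by linarith
  have bounds: "n 0 \<le> e 0 0" "n 0 \<noteq> 0 \<Longrightarrow> e 0 0 + 2 \<le> 2 * n 0" "e 0 0 + 2 * n 0 \<le> 2 * n 1 - 2"
    using n0_le_e00 e00_le n1 by simp_all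
  show "e 0 0 = 2" if "n 0 = 2" using bounds that by simp
  show "e 0 0 = 4" if "n 0 = 4" using bounds that n3 by simp
  show "e 0 0 = 4" if "n 0 = 3"
  proof -
    \<comment> \<open>The value 3 is odd, but arcs inside a level come in pairs.\<close>
    have "e 0 0 = 3 \<or> e 0 0 = 4" using bounds that by linarith
    then show ?thesis using even_e00 by auto
  qed
qed

text \<open>The counting gives \<open>2 * sum f V \<ge> card V + 2 + n 2\<close>, so equality leaves
  no slack: \<open>n 2 = 1\<close>, and the inequalities that were added are tight.\<close>

lemma extremal_n2_neq_0:
  assumes "2 * sum f V = card V + 3" "n 2 \<noteq> 0"
  shows "n 2 = 1" "n 1 = n 0" "e 0 0 = n 0" "2 * e 0 2 = n 0" "e 0 1 + 2 * e 0 2 = 2 * n 0"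
proof -
  have pos: "1 \<le> n 2" using assms(2) by simp
  have *: "2 * n 1 + 4 * n 2 = n 0 + n 1 + n 2 + 3" using assms card_V weight_eq by simp
  have **: "e 0 0 + e 2 2 + 2 * e 0 2 + 2 \<le> 2 * (n 0 + n 2)" using e_L02 assms(2) by simp
  \<comment> \<open>Here \<open>a\<close>, \<open>b\<close>, \<open>c\<close> stand for the level
    sizes \<open>n 0\<close>, \<open>n 1\<close>, \<open>n 2\<close>, and \<open>aij\<close> for
    \<open>e i j\<close>.\<close>
  have arith: "c = 1 \<and> b = a \<and> a00 = a \<and> 2 * a02 = a \<and> a01 + 2 * a02 = 2 * a"
    if "1 \<le> c" "2 * b + 4 * c = a + b + c + 3" "a00 + a22 + 2 * a02 + 2 \<le> 2 * (a + c)"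
      "a00 + a11 + a22 + 2 * (a01 + a02 + a12) + 2 = 2 * (a + b + c)"
      "a \<le> a00" "2 * a \<le> a01 + 2 * a02"
    for a b c a00 a01 a02 a11 a12 a22 :: nat
  proof -
    have lin: "a00 + a22 + 2 * a02 + 2 \<le> 2 * a + 2 * c"
        "a00 + a11 + a22 + 2 * a01 + 2 * a02 + 2 * a12 + 2 = 2 * a + 2 * b + 2 * c"
        using that(3,4) by simp_all
    \<comment> \<open>The sum of the two facts in \<open>lin\<close>, with the nonnegative terms in
      \<open>a11\<close>, \<open>a12\<close> and \<open>a22\<close> dropped.\<close>
    have s1: "2 * a00 + 2 * a01 + 4 * a02 + 4 \<le> 4 * a + 2 * b + 4 * c"
      using lin by linarith
    have s2: "6 * a \<le> 2 * a00 + 2 * a01 + 4 * a02" using that(5,6) by linarith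
    have "c \<le> 1" using s1 s2 that(2) by linarith
    then have c: "c = 1" using that(1) by simp
    have b: "b = a" using that(2) c by simp
    have t: "2 * a02 \<le> a" using that(5) lin(1) c by linarith
    have t2: "a01 + 2 * a02 \<le> 2 * a" using that(5) s1 c b by linarith
    have t3: "a00 \<le> a" using that(6) s1 c b by linarith
    have "a \<le> 2 * a02" using that(5) lin(2) t2 that(6) c b by linarith
    then show ?thesis using that(5,6) t t2 t3 c b by simp
  qed
  show "n 2 = 1" "n 1 = n 0" "e 0 0 = n 0" "2 * e 0 2 = n 0" "e 0 1 + 2 * e 0 2 = 2 * n 0"
    using arith[OF pos * ** e_total n0_le_e00 two_n0_le] by blast+
qed

end

section \<open>Isomorphisms onto edge graphs\<close>

text \<open>Arcs are pairs and an isomorphism respects tails and heads, so its action on arcs is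
  \<open>map_prod h h\<close> for its vertex map \<open>h\<close>.\<close>

lemma digraph_iso_pair_iff:
  assumes "pair_wf_digraph G"
  shows "digraph_iso (with_proj G) (with_proj H) \<longleftrightarrow>
    (\<exists>h. inj_on h (pverts G) \<and> h ` pverts G = pverts H \<and> map_prod h h ` parcs G = parcs H)"
    (is "?L \<longleftrightarrow> ?R")
proof
  assume ?L
  then obtain hom where hom: "pre_digraph.digraph_isomorphism (with_proj G) hom"
    and H: "with_proj H = app_iso hom (with_proj G)" by (auto simp: digraph_iso_def)
  let ?h = "iso_verts hom"
  have "iso_tail hom = fst" "iso_head hom = snd"
    using arg_cong[OF H, of tail] arg_cong[OF H, of head] by simp_all
  then have "iso_arcs hom a = map_prod ?h ?h a" if "a \<in> parcs G" for a
    using hom that by (simp add: pre_digraph.digraph_isomorphism_def prod_eq_iff)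
  then have "map_prod ?h ?h ` parcs G = parcs H"
    using arg_cong[OF H, of arcs] by simp
  moreover have "?h ` pverts G = pverts H" using arg_cong[OF H, of verts] by simp
  moreover have "inj_on ?h (pverts G)"
    using hom by (simp add: pre_digraph.digraph_isomorphism_def)
  ultimately show ?R by blast
next
  interpret pair_wf_digraph G by fact
  assume ?R
  then obtain h where h: "inj_on h (pverts G)" "h ` pverts G = pverts H"
    "map_prod h h ` parcs G = parcs H" by blast
  let ?hom = "\<lparr>iso_verts = h, iso_arcs = map_prod h h, iso_head = snd, iso_tail = fst\<rparr>"
  have "parcs G \<subseteq> pverts G \<times> pverts G" using in_arcsD1 in_arcsD2 by auto
  then have "inj_on (map_prod h h) (parcs G)"
    by (rule inj_on_subset[OF map_prod_inj_on[OF h(1) h(1)]])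
  then have "digraph_isomorphism ?hom"
    using h(1) wf_digraph_wp_iff assms by (auto simp: digraph_isomorphism_def)
  moreover have "with_proj H = app_iso ?hom (with_proj G)"
    using h by (simp add: app_iso_def with_proj_def)
  ultimately show ?L by (auto simp: digraph_iso_def)
qed

section \<open>Embeddings of numbered edge lists\<close>

definition tree_edges :: "nat \<Rightarrow> (nat \<times> nat) set \<Rightarrow> bool" where
  "tree_edges m A \<longleftrightarrow> finite A \<and> (\<forall>(i, j)\<in>A. i < j) \<and> card A + 1 = m \<and> fst ` A \<union> snd ` A = {..<m}"

text \<open>All pairs of \<open>A\<close> increase, so \<open>A\<close> and its converse are
  disjoint and each of the \<open>m - 1\<close> edges yields exactly two arcs.\<close>

lemma card_parcs_edge_graph:
  assumes "tree_edges m A"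
  shows "card (parcs (edge_graph A)) + 2 = 2 * m"
proof -
  from assms have A: "finite A" "card A + 1 = m" and lt: "\<And>i j. (i, j) \<in> A \<Longrightarrow> i < j"
    by (simp_all add: tree_edges_def split_beta Ball_def)
  have "A \<inter> A\<inverse> = {}" using lt less_asym by blast
  then have "card (A \<union> A\<inverse>) = 2 * card A"
    using A(1) by (simp add: card_Un_disjoint)
  then show ?thesis using A(2) by (simp add: edge_graph_def)
qed

definition (in simple_graph) embeds :: "(nat \<times> nat) set \<Rightarrow> bool" where
  "embeds A \<longleftrightarrow> tree_edges (card V) A \<and>
    (\<exists>h. inj_on h {..<card V} \<and> (\<forall>(i, j)\<in>A. (h i, h j) \<in> E))"

text \<open>Entry \<open>i\<close> of \<open>xs\<close> is the image of vertex \<open>i\<close>, so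
  a single tree is recognised by listing its vertices in the order of the target numbering.\<close>

lemma (in simple_graph) embedsI_list:
  assumes "tree_edges (card V) A" "length xs = card V" "distinct xs"
    "\<forall>(i, j)\<in>A. (xs ! i, xs ! j) \<in> E"
  shows "embeds A"
proof -
  have "inj_on ((!) xs) {..<card V}" using assms(2,3) by (simp add: inj_on_nth)
  then show ?thesis using assms(1,2,4) unfolding embeds_def by metis
qed

text \<open>
  An injection that maps the edges of one tree into those of another tree with equally many
  vertices is an isomorphism, because the trees also have equally many edges.
\<close>

lemma digraph_iso_edge_graphI:
  assumes T: "graph_tree T" and A: "simple_graph.embeds (pverts T) (parcs T) A"
  shows "digraph_iso (with_proj T) (with_proj (edge_graph A))"
proof -
  interpret sparse_tree "pverts T" "parcs T" using T by (rule graph_tree_imp_sparse_tree)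
  interpret pair_graph T using T by (simp add: graph_tree_def)
  let ?V = "pverts T" and ?m = "card (pverts T)" and ?J = "edge_graph A"
  have te: "tree_edges ?m A" using A unfolding embeds_def ..
  obtain h where h: "inj_on h {..<?m}" "(i, j) \<in> A \<Longrightarrow> (h i, h j) \<in> parcs T" for i j
    using A unfolding embeds_def split_beta by fastforce
  have ends: "fst ` A \<union> snd ` A = {..<?m}" using te by (simp add: tree_edges_def)
  then have J: "pverts ?J = {..<?m}" "parcs ?J = A \<union> A\<inverse>"
    by (simp_all add: edge_graph_def)
  have sub: "parcs ?J \<subseteq> {..<?m} \<times> {..<?m}"
    unfolding J ends[symmetric] by force
  \<comment> \<open>Every index is an endpoint of some pair in \<open>A\<close>, so its image is an
    endpoint of an arc; injectivity and equal cardinality give surjectivity.\<close>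
  have V: "h ` {..<?m} = ?V"
  proof (rule card_subset_eq[OF finite_V])
    show "h ` {..<?m} \<subseteq> ?V"
    proof
      fix v assume "v \<in> h ` {..<?m}"
      then obtain i where "v = h i" "i \<in> fst ` A \<union> snd ` A" unfolding ends by blast
      then show "v \<in> ?V" using h(2) adj_V by force
    qed
    show "card (h ` {..<?m}) = ?m" using card_image[OF h(1)] by simp
  qed
  have E: "map_prod h h ` parcs ?J = parcs T"
  proof (rule card_subset_eq[OF finite_E])
    show "map_prod h h ` parcs ?J \<subseteq> parcs T" using h(2) adj_sym unfolding J by auto
    have "inj_on (map_prod h h) (parcs ?J)"
      by (rule inj_on_subset[OF map_prod_inj_on[OF h(1) h(1)] sub])
    then show "card (map_prod h h ` parcs ?J) = card (parcs T)"
      using card_parcs_edge_graph[OF te] card_E by (simp add: card_image)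
  qed
  let ?g = "inv_into {..<?m} h"
  have "bij_betw ?g ?V {..<?m}"
    using bij_betw_inv_into[of h "{..<?m}" ?V] V h(1) by (simp add: bij_betw_def)
  then have "inj_on ?g ?V" "?g ` ?V = pverts ?J" unfolding J(1) by (simp_all add: bij_betw_def)
  moreover have "map_prod ?g ?g ` map_prod h h ` parcs ?J = parcs ?J"
  proof -
    have "map_prod ?g ?g (map_prod h h a) = a" if "a \<in> parcs ?J" for a
      using that sub h(1) by (cases a) auto
    then show ?thesis by (simp add: image_image)
  qed
  ultimately show ?thesis
    unfolding digraph_iso_pair_iff[OF pair_wf_digraph] E by (intro exI[of _ ?g] conjI)
qed

section \<open>The family as explicit edge lists\<close>

abbreviation "edges_T1 \<equiv> {(0, 1), (1, 2)} :: (nat \<times> nat) set"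
abbreviation "edges_T2 \<equiv> {(0, 1), (0, 2), (0, 3), (1, 4), (1, 5), (1, 6)} :: (nat \<times> nat) set"
abbreviation "edges_T3 \<equiv>
  {(0, 1), (1, 2), (0, 3), (0, 4), (1, 5), (1, 6), (2, 7), (2, 8)} :: (nat \<times> nat) set"
abbreviation "edges_T4 \<equiv>
  {(0, 3), (0, 1), (0, 2), (3, 4), (3, 5), (5, 6), (6, 7), (6, 8), (8, 9), (8, 10)} :: (nat \<times> nat) set"
abbreviation "edges_T5 \<equiv> {(0, 1), (0, 2), (0, 3), (1, 4), (1, 5), (5, 6)} :: (nat \<times> nat) set"
abbreviation edges_T4k :: "nat \<Rightarrow> (nat \<times> nat) set" where
  "edges_T4k k \<equiv> \<Union>i<k. {(4 * i + 1, 4 * i + 2), (4 * i + 1, 4 * i + 3),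
    (4 * i + 1, 4 * i + 4), (0, 4 * i + 2)}"

lemma T2_eq: "T2 = edge_graph edges_T2"
proof -
  have "{(0, 1)} \<union> {(0, 2 + i) | i. i < 2} \<union> {(1, 2 + 2 + i) | i. i < 3} = edges_T2"
    by (auto simp: numeral_eq_Suc less_Suc_eq)
  then show ?thesis unfolding T2_def double_star_def by simp
qed

lemma T3_eq: "T3 = edge_graph edges_T3"
  unfolding T3_def by (rule arg_cong[of _ _ edge_graph]) auto

text \<open>\<open>T5\<close> is built from the already symmetric arcs of a double star, which
  \<open>edge_graph\<close> symmetrises once more.\<close>

lemma edge_graph_Un_converse: "edge_graph (A \<union> A\<inverse> \<union> B) = edge_graph (A \<union> B)"
proof -
  have "fst ` (A\<inverse>) = snd ` A" "snd ` (A\<inverse>) = fst ` A" by force+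
  then have "fst ` (A \<union> A\<inverse> \<union> B) \<union> snd ` (A \<union> A\<inverse> \<union> B) = fst ` (A \<union> B) \<union> snd ` (A \<union> B)"
    by (simp only: image_Un) blast
  then show ?thesis unfolding edge_graph_def by (simp only: converse_Un converse_converse) blast
qed

lemma T5_eq: "T5 = edge_graph edges_T5"
proof -
  have "{(0, 1)} \<union> {(0, 2 + i) | i. i < 2} \<union> {(1, 2 + 2 + i) | i. i < 2} =
      ({(0, 1), (0, 2), (0, 3), (1, 4), (1, 5)} :: (nat \<times> nat) set)"
    by (auto simp: numeral_eq_Suc less_Suc_eq)
  moreover have "parcs (edge_graph A) = A \<union> A\<inverse>" for A :: "(nat \<times> nat) set"
    by (simp add: edge_graph_def)
  ultimately have "T5 = edge_graph ({(0, 1), (0, 2), (0, 3), (1, 4), (1, 5)} \<union> {(5, 6)})"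
    unfolding T5_def double_star_def by (simp only: edge_graph_Un_converse)
  also have "{(0, 1), (0, 2), (0, 3), (1, 4), (1, 5)} \<union> {(5, 6)} = edges_T5" by auto
  finally show ?thesis .
qed

lemma edge_graph_in_family_J:
  "edge_graph edges_T1 \<in> family_J" "edge_graph edges_T2 \<in> family_J"
  "edge_graph edges_T3 \<in> family_J" "edge_graph edges_T4 \<in> family_J"
  "edge_graph edges_T5 \<in> family_J" "1 \<le> k \<Longrightarrow> edge_graph (edges_T4k k) \<in> family_J"
  unfolding T1_def[symmetric] T2_eq[symmetric] T3_eq[symmetric] T4_def[symmetric]
    T5_eq[symmetric] T4k_def[symmetric] family_J_def by (simp, simp, simp, simp, simp, blast)

lemma tree_edges_sporadic:
  "tree_edges 3 edges_T1" "tree_edges 7 edges_T2" "tree_edges 9 edges_T3"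
  "tree_edges 11 edges_T4" "tree_edges 7 edges_T5"
  unfolding tree_edges_def set_eq_subset by (simp_all add: lessThan_nat_numeral lessThan_Suc)

lemma tree_edges_T4k:
  assumes "1 \<le> k"
  shows "tree_edges (4 * k + 1) (edges_T4k k)"
proof -
  have "card (edges_T4k k) = (\<Sum>i<k. 4)"
    by (subst card_UN_disjoint) auto
  moreover
  have "m \<in> fst ` edges_T4k k \<union> snd ` edges_T4k k" if "m < 4 * k + 1" for m
  proof (cases "m = 0")
    case True
    have "(0, 2) \<in> edges_T4k k" using assms by (auto intro!: bexI[of _ 0])
    then show ?thesis using True by force
  next
    case False
    \<comment> \<open>Copy \<open>i\<close> of the star occupies the block from
      \<open>4 * i + 1\<close> to \<open>4 * i + 4\<close>; the shift by 1 accounts for the vertex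
      0.\<close>
    define i where "i = (m - 1) div 4"
    have "i < k" using that False by (auto simp: i_def)
    then have "(4 * i + 1, 4 * i + 2) \<in> edges_T4k k" "(4 * i + 1, 4 * i + 3) \<in> edges_T4k k"
      "(4 * i + 1, 4 * i + 4) \<in> edges_T4k k" by blast+
    moreover have "{a, b} \<subseteq> fst ` X \<union> snd ` X" if "(a, b) \<in> X" for a b and X :: "(nat \<times> nat) set"
      using that by force
    ultimately have "{4 * i + 1, 4 * i + 2, 4 * i + 3, 4 * i + 4} \<subseteq>
        fst ` edges_T4k k \<union> snd ` edges_T4k k"
      by (meson insert_subset)
    moreover have "m = 4 * i + 1 \<or> m = 4 * i + 2 \<or> m = 4 * i + 3 \<or> m = 4 * i + 4"
      using False unfolding i_def by presburger
    then have "m \<in> {4 * i + 1, 4 * i + 2, 4 * i + 3, 4 * i + 4}" by simp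
    ultimately show ?thesis by (rule subsetD)
  qed
  then have "fst ` edges_T4k k \<union> snd ` edges_T4k k = {..<4 * k + 1}" by auto
  ultimately show ?thesis unfolding tree_edges_def by auto
qed

section \<open>The extremal trees\<close>

lemma ex_two_elements:
  assumes "2 \<le> card S"
  obtains x y where "x \<in> S" "y \<in> S" "x \<noteq> y"
proof -
  obtain S' where "S' \<subseteq> S" "card S' = 2" using assms obtain_subset_with_card_n by metis
  then show thesis using that by (auto simp: card_2_iff)
qed

context rid_tree
begin

lemma two_nbrs:
  assumes "2 \<le> deg S v"
  obtains x y where "x \<in> S" "y \<in> S" "(v, x) \<in> E" "(v, y) \<in> E" "x \<noteq> y"
proof -
  obtain x y where "x \<in> E `` {v} \<inter> S" "y \<in> E `` {v} \<inter> S" "x \<noteq> y"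
    using ex_two_elements[OF assms[unfolded deg_def]] .
  then show thesis using that by blast
qed

lemma two_nbrs_L1:
  assumes "v \<in> L 0" "\<And>z. z \<in> L 2 \<Longrightarrow> (v, z) \<notin> E"
  obtains x y where "x \<in> L 1" "y \<in> L 1" "(v, x) \<in> E" "(v, y) \<in> E" "x \<noteq> y"
proof -
  have "E `` {v} \<inter> L 2 = {}" using assms(2) by blast
  then have "deg (L 2) v = 0" by (simp add: deg_def)
  then have "2 \<le> deg (L 1) v" using deg_L12[OF assms(1)] by simp
  then show thesis using two_nbrs that by metis
qed

lemma L0_L1_neq: "u \<in> L 0 \<Longrightarrow> x \<in> L 1 \<Longrightarrow> u \<noteq> x"
  by (auto simp: L_def)

text \<open>The degrees of the three vertices sum to 4, so some vertex has two neighbours.\<close>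

lemma embeds_T1:
  assumes "card V = 3"
  shows "embeds edges_T1"
proof -
  have "\<exists>c\<in>V. 2 \<le> deg V c"
  proof (rule ccontr)
    assume "\<not> ?thesis"
    then have "deg V c \<le> 1" if "c \<in> V" for c using that by fastforce
    then have "(\<Sum>c\<in>V. deg V c) \<le> (\<Sum>c\<in>V. 1)" by (intro sum_mono)
    moreover have "E \<inter> V \<times> V = E" using E_subset by auto
    then have "card E = (\<Sum>c\<in>V. deg V c)" using card_arcs_eq_sum_deg[OF finite_V] by metis
    ultimately show False using card_E assms by simp
  qed
  then obtain c where "2 \<le> deg V c" by blast
  then obtain x y where "(c, x) \<in> E" "(c, y) \<in> E" "x \<noteq> y" by (rule two_nbrs)
  then show ?thesis
    using assms tree_edges_sporadic adj_sym[of c x] adj_neq[of c]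
    by (intro embedsI_list[of _ "[x, c, y]"]) auto
qed

text \<open>The two vertices of value 0 are adjacent and have two private neighbours of value 1
  each, forming a double star with 2 and 2 leaves. The seventh vertex \<open>p\<close> hangs at a
  centre, giving \<open>T2\<close>, or at a leaf, giving \<open>T5\<close>.\<close>

lemma embeds_T2_or_T5:
  assumes L2: "L 2 = {}" and n0: "n 0 = 2" and V: "card V = 7"
  shows "embeds edges_T2 \<or> embeds edges_T5"
proof -
  obtain a where a: "a \<in> L 0" using n0 by fastforce
  obtain b where b: "b \<in> L 0" "(a, b) \<in> E" using rid a adj_V by (auto simp: rid_on_def L_def)
  obtain x1 x2 where x: "x1 \<in> L 1" "x2 \<in> L 1" "(a, x1) \<in> E" "(a, x2) \<in> E" "x1 \<noteq> x2"
    using two_nbrs_L1[OF a] L2 by blast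
  obtain y1 y2 where y: "y1 \<in> L 1" "y2 \<in> L 1" "(b, y1) \<in> E" "(b, y2) \<in> E" "y1 \<noteq> y2"
    using two_nbrs_L1[OF b(1)] L2 by blast
  have dist: "distinct [a, b, x1, x2, y1, y2]"
    using a b x y adj_neq[of a b] no_triangle[of a b] L0_L1_neq by auto
  let ?S = "{a, b, x1, x2, y1, y2}"
  have "card ?S = 6" using distinct_card[OF dist] by simp
  moreover have "?S \<subseteq> V" using adj_V b x y by blast
  ultimately obtain p where p: "p \<in> V" "p \<notin> ?S" "V = insert p ?S"
  proof -
    assume *: "card ?S = 6" "?S \<subseteq> V"
    then have "card (V - ?S) = 1" using V by (simp add: card_Diff_subset)
    then obtain p where "V - ?S = {p}" by (auto simp: card_1_singleton_iff)
    then show thesis using that[of p] *(2) by blast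
  qed
  obtain q where q: "(p, q) \<in> E" using ex_nbr[OF p(1)] V by auto
  then have "q \<in> ?S" using p(3) adj_V adj_neq by blast
  moreover note sym = adj_sym[OF q] adj_sym[OF b(2)]
  note [simp] = x y b q sym V not_sym[OF x(5)] not_sym[OF y(5)]
  have neqs: "p \<noteq> a" "p \<noteq> b" "p \<noteq> x1" "p \<noteq> x2" "p \<noteq> y1" "p \<noteq> y2" using p(2) by auto
  \<comment> \<open>Each list puts \<open>p\<close> last and its neighbour \<open>q\<close> at
    position 1 for \<open>T2\<close> and position 5 for \<open>T5\<close>, exchanging the two halves
    or two leaves where necessary.\<close>
  have "embeds edges_T2" if "q = a"
    by (rule embedsI_list[of _ "[b, a, y1, y2, x1, x2, p]"])
       (use that dist neqs tree_edges_sporadic sym in auto)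
  moreover have "embeds edges_T2" if "q = b"
    by (rule embedsI_list[of _ "[a, b, x1, x2, y1, y2, p]"])
       (use that dist neqs tree_edges_sporadic sym in auto)
  moreover have "embeds edges_T5" if "q = y2"
    by (rule embedsI_list[of _ "[a, b, x1, x2, y1, y2, p]"])
       (use that dist neqs tree_edges_sporadic sym in auto)
  moreover have "embeds edges_T5" if "q = y1"
    by (rule embedsI_list[of _ "[a, b, x1, x2, y2, y1, p]"])
       (use that dist neqs tree_edges_sporadic sym in auto)
  moreover have "embeds edges_T5" if "q = x2"
    by (rule embedsI_list[of _ "[b, a, y1, y2, x1, x2, p]"])
       (use that dist neqs tree_edges_sporadic sym in auto)
  moreover have "embeds edges_T5" if "q = x1"
    by (rule embedsI_list[of _ "[b, a, y1, y2, x2, x1, p]"])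
       (use that dist neqs tree_edges_sporadic sym in auto)
  ultimately show ?thesis by blast
qed

text \<open>Degrees within level 0 sum to 4 over three vertices, so level 0 is a path with some
  middle vertex \<open>b\<close>. Each of its vertices has two neighbours of value 1, and none is
  shared because the path is connected.\<close>

lemma embeds_T3:
  assumes L2: "L 2 = {}" and n0: "n 0 = 3" and e00: "e 0 0 = 4" and V: "card V = 9"
  shows "embeds edges_T3"
proof -
  have "\<exists>b\<in>L 0. 2 \<le> deg (L 0) b"
  proof (rule ccontr)
    assume "\<not> ?thesis"
    then have "deg (L 0) b \<le> 1" if "b \<in> L 0" for b using that by fastforce
    then have "(\<Sum>b\<in>L 0. deg (L 0) b) \<le> (\<Sum>b\<in>L 0. 1)" by (intro sum_mono)
    then show False using e00 n0 by (simp add: e_eq_sum_deg)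
  qed
  then obtain b where b: "b \<in> L 0" "2 \<le> deg (L 0) b" by blast
  obtain a c where ac: "a \<in> L 0" "c \<in> L 0" "(b, a) \<in> E" "(b, c) \<in> E" "a \<noteq> c"
    using two_nbrs[OF b(2)] by blast
  obtain x1 x2 where x: "x1 \<in> L 1" "x2 \<in> L 1" "(a, x1) \<in> E" "(a, x2) \<in> E" "x1 \<noteq> x2"
    using two_nbrs_L1[OF ac(1)] L2 by blast
  obtain y1 y2 where y: "y1 \<in> L 1" "y2 \<in> L 1" "(b, y1) \<in> E" "(b, y2) \<in> E" "y1 \<noteq> y2"
    using two_nbrs_L1[OF b(1)] L2 by blast
  obtain z1 z2 where z: "z1 \<in> L 1" "z2 \<in> L 1" "(c, z1) \<in> E" "(c, z2) \<in> E" "z1 \<noteq> z2"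
    using two_nbrs_L1[OF ac(2)] L2 by blast
  have neq: "a \<noteq> b" "b \<noteq> c" using ac adj_neq by blast+
  let ?S = "{c, a, b}"
  have S: "subtree ?S"
    using ac neq adj_V by (intro subtree_insert[of _ b] subtree_singleton) auto
  have uniq: "u = v" if "u \<in> ?S" "v \<in> ?S" "(u, w) \<in> E" "(v, w) \<in> E" "w \<in> L 1" for u v w
    using subtree_nbr_unique[OF S, of w u v] that L0_L1_neq ac b by blast
  have "distinct [a, b, c, x1, x2, y1, y2, z1, z2]"
    using neq ac b x y z L0_L1_neq uniq[of a b] uniq[of a c] uniq[of b c] by auto
  then show ?thesis
    using x y z ac V tree_edges_sporadic adj_sym[OF ac(3)]
    by (intro embedsI_list[of _ "[a, b, c, x1, x2, y1, y2, z1, z2]"]) auto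
qed

section \<open>Level 0 as an induced matching: the trees \<open>T4\<close> and
  \<open>T4k\<close>\<close>

lemma deg_L0_eq_1:
  assumes "e 0 0 = n 0" "v \<in> L 0"
  shows "deg (L 0) v = 1"
proof -
  \<comment> \<open>Each degree is at least 1, so equality of the sums forces equality
    termwise.\<close>
  have "(\<Sum>v\<in>L 0. 1) = (\<Sum>v\<in>L 0. deg (L 0) v)" using assms(1) by (simp add: e_eq_sum_deg)
  then show ?thesis using sum_mono_inv[of "\<lambda>_. 1" "L 0" "deg (L 0)" v] deg_L0 assms(2) L_V by metis
qed

lemma mate_unique:
  assumes "e 0 0 = n 0" "v \<in> L 0" "x \<in> L 0" "y \<in> L 0" "(v, x) \<in> E" "(v, y) \<in> E"
  shows "x = y"
proof -
  have "card (E `` {v} \<inter> L 0) = 1" using deg_L0_eq_1 assms(1,2) unfolding deg_def by blast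
  then obtain w where "E `` {v} \<inter> L 0 = {w}" by (auto simp: card_1_singleton_iff)
  then show ?thesis using assms(3-6) by (metis Int_iff Image_singleton_iff singletonD)
qed

lemma ex_mate:
  assumes "v \<in> L 0"
  obtains u where "u \<in> L 0" "(v, u) \<in> E"
proof -
  have "E `` {v} \<inter> L 0 \<noteq> {}" using deg_L0[OF assms] by (auto simp: deg_def)
  then show thesis using that by blast
qed

text \<open>Pigeonhole: adjacent vertices share no neighbour, so the ends of each of the two
  matching edges see at least four vertices of value 1; eight do not fit into seven.\<close>

lemma shared_L1_nbr:
  assumes L2: "L 2 = {}" and n0: "n 0 = 4" and e00: "e 0 0 = n 0" and n1: "n 1 = 7"
  obtains a b c d x where "distinct [a, b, c, d]" "{a, b, c, d} \<subseteq> L 0"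
    "(a, b) \<in> E" "(c, d) \<in> E" "x \<in> L 1" "(b, x) \<in> E" "(c, x) \<in> E"
proof -
  obtain a where a: "a \<in> L 0" using n0 by fastforce
  obtain b where b: "b \<in> L 0" "(a, b) \<in> E" using ex_mate[OF a] .
  have "\<not> L 0 \<subseteq> {a, b}"
  proof
    assume "L 0 \<subseteq> {a, b}"
    then have "n 0 \<le> card {a, b}" by (intro card_mono) auto
    also have "\<dots> \<le> 2" by (simp add: card_insert_if)
    finally show False using n0 by simp
  qed
  then obtain c where c: "c \<in> L 0" "c \<noteq> a" "c \<noteq> b" by blast
  obtain d where d: "d \<in> L 0" "(c, d) \<in> E" using ex_mate[OF c(1)] .
  have "d \<noteq> a" "d \<noteq> b"
    using mate_unique[OF e00] a b c d adj_sym by blast+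
  then have dist: "distinct [a, b, c, d]" using c b(2) d(2) adj_neq by auto
  define N where "N v = E `` {v} \<inter> L 1" for v
  have N2: "2 \<le> card (N v)" if "v \<in> L 0" for v
  proof -
    have "deg (L 2) v = 0" using L2 by (simp add: deg_def)
    then show ?thesis using deg_L12[OF that] by (simp add: deg_def N_def)
  qed
  have fin: "finite (N v)" for v by (simp add: N_def)
  have disj: "N u \<inter> N v = {}" if "(u, v) \<in> E" for u v
    using no_triangle[OF that] by (auto simp: N_def)
  have "(N a \<union> N b) \<inter> (N c \<union> N d) \<noteq> {}"
  proof
    assume *: "(N a \<union> N b) \<inter> (N c \<union> N d) = {}"
    have "card (N a \<union> N b) = card (N a) + card (N b)" "card (N c \<union> N d) = card (N c) + card (N d)"
      using disj b(2) d(2) fin by (simp_all add: card_Un_disjoint)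
    moreover have "card ((N a \<union> N b) \<union> (N c \<union> N d)) = card (N a \<union> N b) + card (N c \<union> N d)"
      using * fin by (intro card_Un_disjoint) auto
    moreover have "card ((N a \<union> N b) \<union> (N c \<union> N d)) \<le> n 1"
      using L_V by (intro card_mono) (auto simp: N_def)
    ultimately show False using N2[OF a] N2[OF b(1)] N2[OF c(1)] N2[OF d(1)] n1 by linarith
  qed
  then obtain u v x where uv: "u \<in> {a, b}" "v \<in> {c, d}" "x \<in> N u" "x \<in> N v" by blast
  \<comment> \<open>Renames the ends of both edges so that the shared neighbour lies between the two
    inner ones.\<close>
  obtain u' v' where "{u, u'} = {a, b}" "{v, v'} = {c, d}" using uv(1,2) by blast
  then have "distinct [u', u, v, v']" "{u', u, v, v'} \<subseteq> L 0" "(u', u) \<in> E" "(v, v') \<in> E"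
    using dist a b c d adj_sym[OF b(2)] adj_sym[OF d(2)] by (auto simp: doubleton_eq_iff)
  then show thesis using uv(3,4) unfolding N_def by (intro that[of u' u v v' x]) auto
qed

text \<open>The path \<open>a, b, x, c, d\<close> is connected, so no other vertex of value 1 is
  adjacent to two of its vertices. The shared neighbour \<open>x\<close> becomes the identified
  leaf, number 5.\<close>

lemma embeds_T4:
  assumes L2: "L 2 = {}" and n0: "n 0 = 4" and e00: "e 0 0 = n 0" and n1: "n 1 = 7"
    and V: "card V = 11"
  shows "embeds edges_T4"
proof -
  obtain a b c d x where dist: "distinct [a, b, c, d]" and L0: "{a, b, c, d} \<subseteq> L 0"
    and ab: "(a, b) \<in> E" and cd: "(c, d) \<in> E" and x: "x \<in> L 1" "(b, x) \<in> E" "(c, x) \<in> E"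
    using shared_L1_nbr[OF L2 n0 e00 n1] .
  have noL2: "\<And>v z. z \<in> L 2 \<Longrightarrow> (v, z) \<notin> E" using L2 by simp
  obtain a1 a2 where a: "a1 \<in> L 1" "a2 \<in> L 1" "(a, a1) \<in> E" "(a, a2) \<in> E" "a1 \<noteq> a2"
    using two_nbrs_L1[of a] noL2 L0 by auto
  obtain d1 d2 where d: "d1 \<in> L 1" "d2 \<in> L 1" "(d, d1) \<in> E" "(d, d2) \<in> E" "d1 \<noteq> d2"
    using two_nbrs_L1[of d] noL2 L0 by auto
  obtain y where y: "y \<in> L 1" "(b, y) \<in> E" "y \<noteq> x"
    using two_nbrs_L1[of b] noL2 L0 by (metis insert_subset)
  obtain z where z: "z \<in> L 1" "(c, z) \<in> E" "z \<noteq> x"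
    using two_nbrs_L1[of c] noL2 L0 by (metis insert_subset)
  have neq_x: "a1 \<noteq> x" "a2 \<noteq> x" "d1 \<noteq> x" "d2 \<noteq> x"
    using no_triangle[OF ab] no_triangle[OF cd] a d x by blast+
  have L0_x: "u \<noteq> x" if "u \<in> {a, b, c, d}" for u using that L0 L0_L1_neq[OF _ x(1)] by blast
  let ?S = "{d, c, x, a, b}"
  have "subtree {a, b}"
    using subtree_insert[of "{b}" b a] subtree_singleton ab adj_sym adj_V dist by auto
  then have "subtree {x, a, b}"
    using x(2) L0_x by (intro subtree_insert[of "{a, b}" b x]) auto
  then have "subtree {c, x, a, b}"
    using adj_sym[OF x(3)] L0_x dist by (intro subtree_insert[of _ x c]) auto
  then have S: "subtree ?S"
    using cd L0_x dist by (intro subtree_insert[of _ c d]) auto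
  have uniq: "u = v" if "u \<in> ?S" "v \<in> ?S" "(u, w) \<in> E" "(v, w) \<in> E" "w \<in> L 1" "w \<noteq> x" for u v w
    using subtree_nbr_unique[OF S, of w u v] that L0_L1_neq L0 by blast
  have neq: "w \<noteq> w'" if "u \<in> ?S" "v \<in> ?S" "u \<noteq> v" "(u, w) \<in> E" "(v, w') \<in> E"
      "w \<in> L 1" "w \<noteq> x" for u v w w'
    using uniq[OF that(1,2,4)] that(3,5-7) by blast
  have neqs: "a \<noteq> b" "a \<noteq> c" "a \<noteq> d" "b \<noteq> c" "b \<noteq> d" "c \<noteq> d" using dist by simp_all
  have "w \<notin> {y, z, d1, d2}" if "w \<in> {a1, a2}" for w
  proof -
    have "(a, w) \<in> E" "w \<in> L 1" "w \<noteq> x" using that a neq_x by blast+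
    then show ?thesis using neq[of a b w y] neq[of a c w z] neq[of a d w d1] neq[of a d w d2]
      neqs y(2) z(2) d(3,4) by simp
  qed
  moreover have "y \<notin> {z, d1, d2}" using neq[of b c y z] neq[of b d y d1] neq[of b d y d2] neqs y z(2) d(3,4) by simp
  moreover have "z \<notin> {d1, d2}" using neq[of c d z d1] neq[of c d z d2] neqs z d(3,4) by simp
  ultimately have "distinct [a1, a2, y, z, d1, d2]" using a(5) d(5) by simp
  moreover have "set [a, b, c, d] \<inter> set [a1, a2, y, z, d1, d2, x] = {}"
    using a d y z x L0 L0_L1_neq by auto
  ultimately have "distinct [a, a1, a2, b, y, x, c, z, d, d1, d2]"
    using dist neq_x y(3) z(3) by auto
  then show ?thesis
    using a d y z x ab cd V tree_edges_sporadic adj_sym[OF x(3)]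
    by (intro embedsI_list[of _ "[a, a1, a2, b, y, x, c, z, d, d1, d2]"]) auto
qed

text \<open>Let \<open>z\<close> be the vertex of value 2. Each neighbour \<open>b i\<close> of
  \<open>z\<close> in level 0 has a mate \<open>c i\<close> that misses \<open>z\<close>, as there
  are no triangles, and hence has two neighbours \<open>p i\<close>, \<open>q i\<close> of value 1.
  Together with \<open>z\<close> these are \<open>4 * k + 1\<close> vertices, the whole
  tree.\<close>

lemma embeds_T4k:
  assumes n2: "n 2 = 1" and n1: "n 1 = n 0" and e00: "e 0 0 = n 0" and e02: "2 * e 0 2 = n 0"
    and V: "card V \<noteq> 1"
  shows "\<exists>k\<ge>1. embeds (edges_T4k k)"
proof -
  obtain z where z: "L 2 = {z}" using n2 by (auto simp: card_1_singleton_iff)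
  then have "z \<in> L 2" by blast
  then have z_notin: "z \<notin> L 0" "z \<notin> L 1" by (auto simp: L_def)
  define k where "k = e 0 2"
  have cV: "card V = 4 * k + 1" using card_V n1 n2 e02 by (simp add: k_def)
  then have k: "1 \<le> k" using V by (cases k) auto
  define B where "B = E `` {z} \<inter> L 0"
  have "card B = k"
    using e_eq_sum_deg[of 2 0] e_commute[of 2 0] z by (simp add: k_def B_def deg_def)
  then obtain b where b: "bij_betw b {0..<k} B"
    using ex_bij_betw_nat_finite[of B] by (auto simp: B_def)
  have bB: "b i \<in> L 0 \<and> (z, b i) \<in> E" if "i < k" for i
    using bij_betwE[OF b] that by (auto simp: B_def)
  have b_inj: "b i = b j \<Longrightarrow> i < k \<Longrightarrow> j < k \<Longrightarrow> i = j" for i j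
    using b by (auto simp: bij_betw_def inj_on_def)
  have "\<exists>c p q. c \<in> L 0 \<and> (b i, c) \<in> E \<and> (z, c) \<notin> E \<and> p \<in> L 1 \<and> q \<in> L 1 \<and>
      (c, p) \<in> E \<and> (c, q) \<in> E \<and> p \<noteq> q" if i: "i < k" for i
  proof -
    obtain c where c: "c \<in> L 0" "(b i, c) \<in> E" using ex_mate bB[OF i] by blast
    have zc: "(z, c) \<notin> E" using no_triangle[of z "b i" c] bB[OF i] c(2) by metis
    have "(c, w) \<notin> E" if "w \<in> L 2" for w
    proof -
      have "w = z" using that unfolding z by simp
      then show ?thesis using zc adj_sym[of c z] by metis
    qed
    then obtain p q where "p \<in> L 1" "q \<in> L 1" "(c, p) \<in> E" "(c, q) \<in> E" "p \<noteq> q"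
      using two_nbrs_L1[OF c(1)] by metis
    then show ?thesis using c zc by blast
  qed
  then obtain c p q where cpq: "\<And>i. i < k \<Longrightarrow> c i \<in> L 0 \<and> (b i, c i) \<in> E \<and> (z, c i) \<notin> E \<and>
      p i \<in> L 1 \<and> q i \<in> L 1 \<and> (c i, p i) \<in> E \<and> (c i, q i) \<in> E \<and> p i \<noteq> q i"
    by metis
  have c_inj: "i = j" if "c i = c j" "i < k" "j < k" for i j
    using mate_unique[OF e00, of "c i" "b i" "b j"] cpq bB that adj_sym b_inj by metis
  have cb: "c i \<noteq> b j" if "i < k" "j < k" for i j
    using cpq[OF that(1)] bB[OF that(2)] by metis
  \<comment> \<open>A common neighbour of two mates would close a cycle through \<open>z\<close>:
    the set \<open>?S\<close> is grown outwards from \<open>z\<close> along both branches.\<close>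
  have leaf: "i = j" if ij: "i < k" "j < k" and w: "w \<in> L 1" "(c i, w) \<in> E" "(c j, w) \<in> E" for i j w
  proof (rule ccontr)
    assume "i \<noteq> j"
    let ?S = "{c j, c i, b j, b i, z}"
    note facts = bB[OF ij(1)] bB[OF ij(2)] cpq[OF ij(1)] cpq[OF ij(2)] z_notin
    have neq: "c i \<noteq> c j" "b i \<noteq> b j" "c i \<noteq> b j" "c j \<noteq> b i" "c i \<noteq> b i" "c j \<noteq> b j"
      using \<open>i \<noteq> j\<close> ij c_inj b_inj cb by blast+
    have neq_z: "u \<noteq> z" if "u \<in> {c j, c i, b j, b i}" for u using that facts by blast
    have "subtree {b i, z}"
      using facts adj_V neq_z by (intro subtree_insert[of "{z}" z] subtree_singleton) auto
    then have "subtree {b j, b i, z}"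
      using facts neq neq_z by (intro subtree_insert[of "{b i, z}" z]) auto
    then have "subtree {c i, b j, b i, z}"
      using facts neq neq_z by (intro subtree_insert[of "{b j, b i, z}" "b i"]) auto
    then have "subtree ?S"
      using facts neq neq_z by (intro subtree_insert[of "{c i, b j, b i, z}" "b j"]) auto
    moreover have "w \<notin> ?S" using facts w(1) L0_L1_neq by blast
    ultimately show False using subtree_nbr_unique[of ?S w "c i" "c j"] w neq by blast
  qed
  \<comment> \<open>\<open>g r i\<close> is the image of vertex \<open>4 * i + 1 + r\<close>: the
    star centre is \<open>c i\<close>, and its leaf joined to \<open>z\<close> is
    \<open>b i\<close>.\<close>
  define g where "g r i = (if r = 0 then c i else if r = 1 then b i else if r = 2 then p i else q i)"
    for r i :: nat
  have g_inj: "r = s \<and> i = j" if g: "g r i = g s j" and lt: "r < 4" "s < 4" "i < k" "j < k" for r s i j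
  proof -
    note facts = bB[OF lt(3)] bB[OF lt(4)] cpq[OF lt(3)] cpq[OF lt(4)]
    have L01: "c i \<noteq> p j" "c i \<noteq> q j" "b i \<noteq> p j" "b i \<noteq> q j"
      "p i \<noteq> c j" "q i \<noteq> c j" "p i \<noteq> b j" "q i \<noteq> b j" using facts L0_L1_neq by metis+
    have pq: "p i \<noteq> q j" "q i \<noteq> p j" using facts leaf[OF lt(3,4)] by metis+
    have inj: "p i = p j \<Longrightarrow> i = j" "q i = q j \<Longrightarrow> i = j" "c i = c j \<Longrightarrow> i = j" "b i = b j \<Longrightarrow> i = j"
      using facts leaf[OF lt(3,4)] c_inj b_inj lt by metis+
    have "r = 0 \<or> r = 1 \<or> r = 2 \<or> r = 3" "s = 0 \<or> s = 1 \<or> s = 2 \<or> s = 3"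
      using lt(1,2) by linarith+
    then show ?thesis
      using g cb[OF lt(3,4)] cb[OF lt(4,3), symmetric]
      by (elim disjE) (simp_all add: g_def L01 pq, auto dest: inj)
  qed
  have g_neq_z: "g r i \<noteq> z" if "i < k" for r i
    using bB[OF that] cpq[OF that] z_notin by (auto simp: g_def)
  define h where "h m = (if m = 0 then z else g ((m - 1) mod 4) ((m - 1) div 4))" for m :: nat
  have div_less: "(m - 1) div 4 < k" if "m \<noteq> 0" "m < 4 * k + 1" for m
    using that by (simp add: div_less_iff_less_mult)
  have h_0: "h 0 = z" by (simp add: h_def)
  have h_z: "h m \<noteq> z" if "m \<noteq> 0" "m < 4 * k + 1" for m
    using g_neq_z[OF div_less[OF that]] that(1) by (simp add: h_def)
  have "inj_on h {..<4 * k + 1}"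
  proof (rule inj_onI)
    fix x y assume "x \<in> {..<4 * k + 1}" "y \<in> {..<4 * k + 1}" and xy: "h x = h y"
    then have lt: "x < 4 * k + 1" "y < 4 * k + 1" by simp_all
    show "x = y"
    proof (cases "x = 0 \<or> y = 0")
      case True
      then show ?thesis using xy lt h_0 h_z by metis
    next
      case False
      then have nz: "x \<noteq> 0" "y \<noteq> 0" by simp_all
      have "g ((x - 1) mod 4) ((x - 1) div 4) = g ((y - 1) mod 4) ((y - 1) div 4)"
        using xy nz by (simp add: h_def)
      then have "(x - 1) mod 4 = (y - 1) mod 4 \<and> (x - 1) div 4 = (y - 1) div 4"
        by (rule g_inj) (use nz lt div_less in simp_all)
      then have "x - 1 = y - 1" by (metis div_mult_mod_eq)
      then show ?thesis using nz by simp
    qed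
  qed
  moreover have edge: "(h i, h j) \<in> E" if "(i, j) \<in> edges_T4k k" for i j
  proof -
    have h_eq: "h (4 * m + r) = g (r - 1) m" if r: "1 \<le> r" "r \<le> 4" for m r
    proof -
      obtain s where "r = Suc s" using r(1) by (cases r) auto
      then show ?thesis using r(2) unfolding h_def by simp
    qed
    have val: "h (4 * m + 1) = c m" "h (4 * m + 2) = b m" "h (4 * m + 3) = p m"
      "h (4 * m + 4) = q m" for m
      by (subst h_eq, simp, simp, simp add: g_def)+
    from that obtain m where m: "m < k" "(i, j) \<in> {(4 * m + 1, 4 * m + 2), (4 * m + 1, 4 * m + 3),
        (4 * m + 1, 4 * m + 4), (0, 4 * m + 2)}" by blast
    have "(c m, b m) \<in> E" using adj_sym cpq[OF m(1)] by blast
    then have "(h (4 * m + 1), h (4 * m + 2)) \<in> E" "(h (4 * m + 1), h (4 * m + 3)) \<in> E"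
      "(h (4 * m + 1), h (4 * m + 4)) \<in> E" "(h 0, h (4 * m + 2)) \<in> E"
      unfolding val h_0 using bB[OF m(1)] cpq[OF m(1)] by simp_all
    then show ?thesis using m(2) by (elim insertE emptyE Pair_inject) (simp_all only:)
  qed
  moreover have "\<forall>(i, j)\<in>edges_T4k k. (h i, h j) \<in> E"
  proof
    fix x assume "x \<in> edges_T4k k"
    then have "(fst x, snd x) \<in> edges_T4k k" by (simp only: prod.collapse)
    then have "(h (fst x), h (snd x)) \<in> E" by (rule edge)
    then show "case x of (i, j) \<Rightarrow> (h i, h j) \<in> E" by (simp only: split_beta)
  qed
  moreover note tree_edges_T4k[OF k]
  ultimately have "embeds (edges_T4k k)" unfolding embeds_def cV by (intro conjI exI[of _ h])
  then show ?thesis using k by (intro exI[of _ k] conjI)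
qed

lemma extremal_embeds:
  assumes "2 * sum f V = card V + 3" "card V \<noteq> 1"
  shows "\<exists>A. edge_graph A \<in> family_J \<and> embeds A"
proof (cases "n 2 = 0")
  case True
  note x = extremal_n2_eq_0[OF assms(1) True]
  have L2: "L 2 = {}" using True L_V by simp
  \<comment> \<open>The four possible values of \<open>n 0\<close> thus give the orders 3, 7, 9 and
    11.\<close>
  have cV: "card V = 2 * n 0 + 3" using card_V True x(1) by simp
  from x(2) consider "n 0 = 0" | "n 0 = 2" | "n 0 = 3" | "n 0 = 4" by metis
  then show ?thesis
  proof cases
    case 1
    then have "embeds edges_T1" using cV by (intro embeds_T1) simp
    then show ?thesis using edge_graph_in_family_J by blast
  next
    case 2
    then have "embeds edges_T2 \<or> embeds edges_T5" using cV L2 by (intro embeds_T2_or_T5) simp_all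
    then show ?thesis using edge_graph_in_family_J by blast
  next
    case 3
    then have "embeds edges_T3" using cV L2 x(4) by (intro embeds_T3) simp_all
    then show ?thesis using edge_graph_in_family_J by blast
  next
    case 4
    then have "embeds edges_T4" using cV L2 x(1,5) by (intro embeds_T4) simp_all
    then show ?thesis using edge_graph_in_family_J by blast
  qed
next
  case False
  note x = extremal_n2_neq_0[OF assms(1) False]
  show ?thesis using embeds_T4k[OF x(1-4) assms(2)] edge_graph_in_family_J(6) by blast
qed

end

section \<open>RID functions on the family\<close>

lemma rid_onI:
  assumes "finite E" "\<And>v. f v \<le> 2"
    and "\<And>v. v \<in> V \<Longrightarrow> f v = 0 \<Longrightarrow> \<exists>u. (v, u) \<in> E \<and> f u = 0"
    and dom: "\<And>v. v \<in> V \<Longrightarrow> f v = 0 \<Longrightarrow> (\<exists>x. (v, x) \<in> E \<and> f x = 2) \<or>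
      (\<exists>x y. x \<noteq> y \<and> (v, x) \<in> E \<and> (v, y) \<in> E \<and> f x \<noteq> 0 \<and> f y \<noteq> 0)"
  shows "rid_on V E f"
proof -
  have "2 \<le> (\<Sum>u\<in>E `` {v}. f u)" if v: "v \<in> V" "f v = 0" for v
  proof -
    have fin: "finite (E `` {v})" using assms(1) by (rule finite_Image)
    from dom[OF v] show ?thesis
    proof (elim disjE exE conjE)
      fix x assume x: "(v, x) \<in> E" "f x = 2"
      then have "f x \<le> (\<Sum>u\<in>E `` {v}. f u)" using fin by (intro member_le_sum) auto
      then show ?thesis using x(2) by simp
    next
      fix x y assume xy: "x \<noteq> y" "(v, x) \<in> E" "(v, y) \<in> E" "f x \<noteq> 0" "f y \<noteq> 0"
      then have "(\<Sum>u\<in>{x, y}. f u) \<le> (\<Sum>u\<in>E `` {v}. f u)" using fin by (intro sum_mono2) auto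
      then show ?thesis using xy by simp
    qed
  qed
  then show ?thesis using assms(2,3) unfolding rid_on_def by (metis Image_singleton_iff)
qed

text \<open>
  A quadruple \<open>(v, u, x, y)\<close> certifies the vertex \<open>v\<close> of value 0: its neighbours include \<open>u\<close> of value 0
  and \<open>x\<close>, \<open>y\<close> of value 1.
\<close>

lemma rid_on_zero_one:
  assumes "finite E" "Z = fst ` W"
    and W: "\<And>v u x y. (v, u, x, y) \<in> W \<Longrightarrow> u \<in> Z \<and> x \<notin> Z \<and> y \<notin> Z \<and> x \<noteq> y \<and>
      (v, u) \<in> E \<and> (v, x) \<in> E \<and> (v, y) \<in> E"
  shows "rid_on V E (\<lambda>v. if v \<in> Z then 0 else 1)"
proof (rule rid_onI)
  fix v assume "(if v \<in> Z then 0 else 1 :: nat) = 0"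
  then have "v \<in> Z" by (simp split: if_splits)
  then obtain u x y where "(v, u, x, y) \<in> W" using assms(2) by auto
  note w = W[OF this]
  show "\<exists>u. (v, u) \<in> E \<and> (if u \<in> Z then 0 else 1 :: nat) = 0" using w by auto
  show "(\<exists>x. (v, x) \<in> E \<and> (if x \<in> Z then 0 else 1 :: nat) = 2) \<or>
      (\<exists>x y. x \<noteq> y \<and> (v, x) \<in> E \<and> (v, y) \<in> E \<and> (if x \<in> Z then 0 else 1 :: nat) \<noteq> 0 \<and>
        (if y \<in> Z then 0 else 1 :: nat) \<noteq> 0)"
    using w by (intro disjI2 exI[of _ x] exI[of _ y]) simp
qed (use assms(1) in auto)

text \<open>The order lies in the range of \<open>weight_lower_bound\<close>, and \<open>g\<close>
  attains that bound.\<close>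

definition rid_sharp :: "'a pair_pre_digraph \<Rightarrow> bool" where
  "rid_sharp J \<longleftrightarrow> card (pverts J) \<notin> {1, 2, 6} \<and>
    (\<exists>g. rid_on (pverts J) (parcs J) g \<and> 2 * sum g (pverts J) = card (pverts J) + 3)"

lemma rid_sharpI:
  assumes "tree_edges m A" "m \<notin> {1, 2, 6}" "rid_on {..<m} (A \<union> A\<inverse>) g"
    "2 * sum g {..<m} = m + 3"
  shows "rid_sharp (edge_graph A)"
proof -
  have "pverts (edge_graph A) = {..<m}" "parcs (edge_graph A) = A \<union> A\<inverse>"
    using assms(1) by (simp_all add: edge_graph_def tree_edges_def)
  then show ?thesis using assms(2-4) unfolding rid_sharp_def by auto
qed

lemma rid_sharp_zero_one:
  assumes te: "tree_edges m A" and m: "m \<notin> {1, 2, 6}"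
    and W: "\<forall>(v, u, x, y)\<in>W. u \<in> fst ` W \<and> x \<notin> fst ` W \<and> y \<notin> fst ` W \<and> x \<noteq> y \<and>
      (v, u) \<in> A \<union> A\<inverse> \<and> (v, x) \<in> A \<union> A\<inverse> \<and> (v, y) \<in> A \<union> A\<inverse>"
    and sum: "2 * (\<Sum>v<m. if v \<in> fst ` W then 0 else 1) = m + 3"
  shows "rid_sharp (edge_graph A)"
  using te m
proof (rule rid_sharpI)
  show "rid_on {..<m} (A \<union> A\<inverse>) (\<lambda>v. if v \<in> fst ` W then 0 else 1)"
    by (rule rid_on_zero_one[OF _ refl]) (use te W in \<open>auto simp: tree_edges_def\<close>)
qed (use sum in simp)

text \<open>The zeros are: none for \<open>T1\<close>; the two centres of the double star for
  \<open>T2\<close> and \<open>T5\<close>; the path for \<open>T3\<close>; the four centres of the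
  two double stars for \<open>T4\<close>. All other vertices get 1.\<close>

lemma rid_sharp_sporadic:
  "rid_sharp (edge_graph edges_T1)" "rid_sharp (edge_graph edges_T2)"
  "rid_sharp (edge_graph edges_T3)" "rid_sharp (edge_graph edges_T4)"
  "rid_sharp (edge_graph edges_T5)"
proof -
  note te = tree_edges_sporadic
  show "rid_sharp (edge_graph edges_T1)"
    by (rule rid_sharp_zero_one[OF te(1), of "{}"]) (simp_all add: lessThan_nat_numeral)
  show "rid_sharp (edge_graph edges_T2)"
    by (rule rid_sharp_zero_one[OF te(2), of "{(0, 1, 2, 3), (1, 0, 4, 5)}"])
      (simp_all add: lessThan_nat_numeral)
  show "rid_sharp (edge_graph edges_T3)"
    by (rule rid_sharp_zero_one[OF te(3), of "{(0, 1, 3, 4), (1, 0, 5, 6), (2, 1, 7, 8)}"])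
      (simp_all add: lessThan_nat_numeral)
  show "rid_sharp (edge_graph edges_T4)"
    by (rule rid_sharp_zero_one[OF te(4), of "{(0, 3, 1, 2), (3, 0, 4, 5), (6, 8, 5, 7), (8, 6, 9, 10)}"])
      (simp_all add: lessThan_nat_numeral)
  show "rid_sharp (edge_graph edges_T5)"
    by (rule rid_sharp_zero_one[OF te(5), of "{(0, 1, 2, 3), (1, 0, 4, 5)}"])
      (simp_all add: lessThan_nat_numeral)
qed

lemma rid_sharp_T4k:
  assumes k: "1 \<le> k"
  shows "rid_sharp (edge_graph (edges_T4k k))"
proof -
  define A where "A = edges_T4k k"
  \<comment> \<open>In each copy the centre and the leaf joined to \<open>z\<close> get 0, the other
    two leaves 1. The vertex 0 is treated first because it shares its residue with the leaves
    \<open>4 * i + 4\<close>.\<close>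
  define g where "g v = (if v = 0 then 2 else if v mod 4 = 1 \<or> v mod 4 = 2 then 0 else 1 :: nat)" for v :: nat
  have te: "tree_edges (4 * k + 1) A" unfolding A_def using k by (rule tree_edges_T4k)
  have A: "(4 * i + 1, 4 * i + 2) \<in> A" "(4 * i + 1, 4 * i + 3) \<in> A"
    "(4 * i + 1, 4 * i + 4) \<in> A" "(0, 4 * i + 2) \<in> A" if "i < k" for i
    using that unfolding A_def by blast+
  have g0: "g 0 = 2" by (simp add: g_def)
  have g: "g (4 * i + 1) = 0" "g (4 * i + 2) = 0" "g (4 * i + 3) = 1"
    "g (4 * i + 4) = 1" for i
  proof -
    have "(4 * i + 1) mod 4 = 1" "(4 * i + 2) mod 4 = 2" "(4 * i + 3) mod 4 = 3" "(4 * i + 4) mod 4 = 0"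
      by presburger+
    then show "g (4 * i + 1) = 0" "g (4 * i + 2) = 0" "g (4 * i + 3) = 1"
      "g (4 * i + 4) = 1" unfolding g_def by simp_all
  qed
  have zero: "\<exists>i<k. v = 4 * i + 1 \<or> v = 4 * i + 2" if "v < 4 * k + 1" "g v = 0" for v
  proof -
    have "v mod 4 = 1 \<or> v mod 4 = 2" using that(2) by (simp add: g_def split: if_splits)
    moreover have "v = 4 * (v div 4) + v mod 4" by simp
    ultimately have "v = 4 * (v div 4) + 1 \<or> v = 4 * (v div 4) + 2" "v div 4 < k"
      using that(1) by linarith+
    then show ?thesis by blast
  qed
  have "rid_on {..<4 * k + 1} (A \<union> A\<inverse>) g"
  proof (rule rid_onI)
    show "finite (A \<union> A\<inverse>)" using te by (simp add: tree_edges_def)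
    show "g v \<le> 2" for v by (simp add: g_def)
    fix v assume v: "v \<in> {..<4 * k + 1}" "g v = 0"
    then obtain i where i: "i < k" "v = 4 * i + 1 \<or> v = 4 * i + 2" using zero by (meson lessThan_iff)
    show "\<exists>u. (v, u) \<in> A \<union> A\<inverse> \<and> g u = 0"
      using i(2)
    proof
      assume "v = 4 * i + 1"
      then show ?thesis using A(1)[OF i(1)] g(2)[of i] by blast
    next
      assume "v = 4 * i + 2"
      then show ?thesis using A(1)[OF i(1)] g(1)[of i] by blast
    qed
    show "(\<exists>x. (v, x) \<in> A \<union> A\<inverse> \<and> g x = 2) \<or>
      (\<exists>x y. x \<noteq> y \<and> (v, x) \<in> A \<union> A\<inverse> \<and> (v, y) \<in> A \<union> A\<inverse> \<and> g x \<noteq> 0 \<and> g y \<noteq> 0)"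
      using i(2)
    proof
      assume "v = 4 * i + 1"
      then have "(v, 4 * i + 3) \<in> A" "(v, 4 * i + 4) \<in> A" using A(2,3)[OF i(1)] by simp_all
      moreover have "4 * i + 3 \<noteq> 4 * i + 4" "g (4 * i + 3) \<noteq> 0" "g (4 * i + 4) \<noteq> 0"
        unfolding g by simp_all
      ultimately show ?thesis by blast
    next
      assume "v = 4 * i + 2"
      then show ?thesis using A(4)[OF i(1)] g0 by blast
    qed
  qed
  moreover have "sum g {..<4 * j + 1} = 2 * j + 2" for j
  proof (induction j)
    case (Suc j)
    have "{..<4 * Suc j + 1} =
        insert (4 * j + 4) (insert (4 * j + 3) (insert (4 * j + 2) (insert (4 * j + 1) {..<4 * j + 1})))"
      by auto
    then show ?case using Suc g[of j] by simp
  qed (simp add: g0)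
  then have "2 * sum g {..<4 * k + 1} = 4 * k + 1 + 3" by simp
  moreover have "4 * k + 1 \<notin> {1, 2, 6}" using k by simp presburger
  ultimately show ?thesis using rid_sharpI[OF te] unfolding A_def by blast
qed

lemma family_J_rid_sharp:
  assumes "J \<in> family_J"
  shows "rid_sharp J"
proof -
  have "J \<in> {T1, T2, T3, T4, T5} \<or> (\<exists>k\<ge>1. J = T4k k)"
    using assms unfolding family_J_def by blast
  then show ?thesis
    using rid_sharp_sporadic rid_sharp_T4k
    unfolding T1_def T2_eq T3_eq T4_def T5_eq T4k_def by auto
qed

lemma rid_on_transport:
  assumes "E \<subseteq> V \<times> V" "inj_on h V" "h ` V = V'" "map_prod h h ` E = E'" "rid_on V' E' g"
  shows "rid_on V E (g \<circ> h)"
proof -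
  have nbrs: "E' `` {h v} = h ` (E `` {v})" if "v \<in> V" for v
    using assms(1,2,4) that by (auto simp: inj_on_def)
  have sum: "(\<Sum>u\<in>E' `` {h v}. g u) = (\<Sum>u\<in>E `` {v}. (g \<circ> h) u)" if "v \<in> V" for v
    unfolding nbrs[OF that]
  proof (rule sum.reindex)
    show "inj_on h (E `` {v})" using assms(1,2) by (auto intro: inj_on_subset)
  qed
  have "\<forall>v\<in>V. g (h v) \<le> 2" "\<forall>v\<in>V. g (h v) = 0 \<longrightarrow> 2 \<le> (\<Sum>u\<in>E' `` {h v}. g u) \<and> (\<exists>u\<in>E' `` {h v}. g u = 0)"
    using assms(3,5) unfolding rid_on_def by blast+
  then show ?thesis unfolding rid_on_def comp_apply using sum nbrs by (simp add: comp_def)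
qed

section \<open>The minimum weight and the characterisation\<close>

lemma gamma_rI_attained:
  assumes "pair_graph G"
  obtains f where "rid_on (pverts G) (parcs G) f" "sum f (pverts G) = gamma_rI (with_proj G)"
proof -
  let ?P = "\<lambda>k. \<exists>f. restrained_italian_dominating (with_proj G) f \<and> weight (with_proj G) f = k"
  have "rid_on (pverts G) (parcs G) (\<lambda>_. 1)" by (simp add: rid_on_def)
  then have "?P (weight (with_proj G) (\<lambda>_. 1))"
    using restrained_italian_dominating_iff[OF assms] by blast
  then have "?P (gamma_rI (with_proj G))" unfolding gamma_rI_def by (rule LeastI[of ?P])
  then show thesis
    using that restrained_italian_dominating_iff[OF assms] by (auto simp: weight_def)
qed

lemma gamma_rI_le:
  assumes "pair_graph G" "rid_on (pverts G) (parcs G) f"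
  shows "gamma_rI (with_proj G) \<le> sum f (pverts G)"
proof -
  have "restrained_italian_dominating (with_proj G) f \<and> weight (with_proj G) f = sum f (pverts G)"
    using assms restrained_italian_dominating_iff by (auto simp: weight_def)
  then show ?thesis unfolding gamma_rI_def by (intro Least_le) blast
qed

theorem theorem3p2:
  fixes T :: "'a pair_pre_digraph"
  assumes "graph_tree T"
  shows "real (gamma_rI (with_proj T)) = (real (card (pverts T)) + 3) / 2 \<longleftrightarrow>
    (\<exists>J\<in>family_J. digraph_iso (with_proj T) (with_proj J))"
proof -
  let ?V = "pverts T" and ?E = "parcs T" and ?\<gamma> = "gamma_rI (with_proj T)"
  have pg: "pair_graph T" using assms by (simp add: graph_tree_def)
  then have wf: "pair_wf_digraph T" by (simp add: pair_graph_def pair_digraph_def pair_fin_digraph_def)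
  interpret sparse_tree ?V ?E using assms by (rule graph_tree_imp_sparse_tree)
  obtain f where f: "rid_on ?V ?E f" "sum f ?V = ?\<gamma>" using gamma_rI_attained[OF pg] .
  interpret rid_tree ?V ?E f by unfold_locales (rule f(1))
  have "2 * ?\<gamma> = card ?V + 3 \<longleftrightarrow> (\<exists>J\<in>family_J. digraph_iso (with_proj T) (with_proj J))"
  proof
    assume eq: "2 * ?\<gamma> = card ?V + 3"
    \<comment> \<open>The constant 1 bounds the minimum by the order, which rules out order 1, where
      equality would require weight 2.\<close>
    have "rid_on ?V ?E (\<lambda>_. 1)" by (simp add: rid_on_def)
    then have "?\<gamma> \<le> card ?V" using gamma_rI_le[OF pg, of "\<lambda>_. 1"] by simp
    then have "card ?V \<noteq> 1" using eq by linarith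
    then obtain A where "edge_graph A \<in> family_J" "embeds A"
      using extremal_embeds f(2) eq by auto
    then show "\<exists>J\<in>family_J. digraph_iso (with_proj T) (with_proj J)"
      using digraph_iso_edge_graphI[OF assms] by blast
  next
    assume "\<exists>J\<in>family_J. digraph_iso (with_proj T) (with_proj J)"
    then obtain J where J: "J \<in> family_J" "digraph_iso (with_proj T) (with_proj J)" by blast
    then obtain h where h: "inj_on h ?V" "h ` ?V = pverts J" "map_prod h h ` ?E = parcs J"
      unfolding digraph_iso_pair_iff[OF wf] by blast
    have card: "card (pverts J) = card ?V" using h(1,2) card_image by metis
    obtain g where g: "rid_on (pverts J) (parcs J) g" "2 * sum g (pverts J) = card ?V + 3"
      and small: "card ?V \<notin> {1, 2, 6}"
      using family_J_rid_sharp[OF J(1)] unfolding rid_sharp_def card by blast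
    \<comment> \<open>Pulling \<open>g\<close> back along the isomorphism gives the upper bound; the
      lower bound applies to the minimiser \<open>f\<close>.\<close>
    have "sum (g \<circ> h) ?V = sum g (pverts J)" using sum.reindex[OF h(1), of g] h(2) by simp
    then have "2 * ?\<gamma> \<le> card ?V + 3"
      using gamma_rI_le[OF pg rid_on_transport[OF E_subset h g(1)]] g(2) by simp
    moreover have "card ?V + 3 \<le> 2 * ?\<gamma>" using weight_lower_bound[OF small] f(2) by simp
    ultimately show "2 * ?\<gamma> = card ?V + 3" by simp
  qed
  moreover have "real ?\<gamma> = (real (card ?V) + 3) / 2 \<longleftrightarrow> 2 * ?\<gamma> = card ?V + 3"
    unfolding of_nat_eq_iff[where 'a = real, symmetric] by (simp add: field_simps)
  ultimately show ?thesis by blast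
qed

end
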